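(* Let $k\ge 1$, let $S\subset\mathbb{R}^k$ be a halfspace, and let $\Sigma\subseteq S$ be an additive semigroup (i.e. $\lambda,\mu\in\Sigma$ implies $\lambda+\mu\in\Sigma$) with $0\in\Sigma$. Then the unital algebras $AP^k_{\Sigma}$ and $APW^k_{\Sigma}$ are Hermite rings.
   Context: $AP^k$ is the algebra of complex valued almost periodic functions of $k$ real variables: the closed subalgebra of $L^\infty(\mathbb{R}^k)$ generated by the functions $e_\lambda(x)=e^{i\langle\lambda,x\rangle}$, $\lambda\in\mathbb{R}^k$, where $\langle\cdot,\cdot\rangle$ is the standard inner product on $\mathbb{R}^k$; its norm is $\|\cdot\|_\infty$. For $f\in AP^k$ and $\lambda\in\mathbb{R}^k$ put $f_\lambda=\lim_{T\to\infty}\frac{1}{(2T)^k}\int_{[-T,T]^k}e^{-i\langle\lambda,x\rangle}f(x)\,dx$; the Bohr-Fourier spectrum of $f$ is $\sigma(f)=\{\lambda\in\mathbb{R}^k: f_\lambda\ne 0\}$ (an at most countable set), and the Bohr-Fourier series of $f$ is the formal sum $\sum_{\lambda\in\sigma(f)} f_\lambda e^{i\langle\lambda,t\rangle}$. The Wiener algebra $APW^k$ is the set of $f\in AP^k$ whose Bohr-Fourier series converges absolutely, with norm $\|f\|_W=\sum_\lambda|f_\lambda|$ and pointwise multiplication. For nonempty $\Delta\subseteq\mathbb{R}^k$: $AP^k_\Delta=\{f\in AP^k:\sigma(f)\subseteq\Delta\}$ and $APW^k_\Delta=\{f\in APW^k:\sigma(f)\subseteq\Delta\}$. A subset $S\subset\mathbb{R}^k$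 is a halfspace if (i) $\mathbb{R}^k=S\cup(-S)$; (ii) $S\cap(-S)=\{0\}$; (iii) $\lambda,\mu\in S$ implies $\lambda+\mu\in S$; (iv) $\lambda\in S$ and $\alpha\ge 0$ real imply $\alpha\lambda\in S$. A commutative ring $\mathcal{R}$ with unity $e$ is a Hermite ring if every unimodular row can be complemented: whenever $a_1,\dots,a_m\in\mathcal{R}$ are such that $a_1b_1+\cdots+a_mb_m=e$ for some $b_1,\dots,b_m\in\mathcal{R}$, there exist $m\times m$ matrices $F$ and $G$ with entries in $\mathcal{R}$ such that $(a_1,\dots,a_m)$ is the first row of $F$ and $FG=I$. *)

theory Defs
  imports "HOL-Analysis.Analysis" "HOL-Algebra.Ring"
begin

text \<open>
  The space of dimension $k$ is \<open>real ^ 'n\<close> with \<open>k = CARD('n)\<close>. Elements of the algebra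
  of almost periodic functions are represented by functions and not by classes modulo null sets:
  every class has exactly one continuous representative, and for those the essential
  supremum is the supremum (\<open>AE_bound_iff_bound\<close>, \<open>Linf_limit_AP\<close> below).
\<close>

definition expo :: "real ^ 'n \<Rightarrow> real ^ 'n \<Rightarrow> complex" where
  "expo l x = exp (\<i> * complex_of_real (l \<bullet> x))"

inductive_set AP :: "(real ^ 'n \<Rightarrow> complex) set" where
  AP_expo: "expo l \<in> AP"
| AP_add: "f \<in> AP \<Longrightarrow> g \<in> AP \<Longrightarrow> (\<lambda>x. f x + g x) \<in> AP"
| AP_scale: "f \<in> AP \<Longrightarrow> (\<lambda>x. c * f x) \<in> AP"
| AP_mult: "f \<in> AP \<Longrightarrow> g \<in> AP \<Longrightarrow> (\<lambda>x. f x * g x) \<in> AP"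
| AP_limit: "(\<And>n::nat. F n \<in> AP) \<Longrightarrow> uniform_limit UNIV F f sequentially \<Longrightarrow> f \<in> AP"

text \<open>The limit defining \<open>bohr_coeff f l\<close> exists for every almost periodic \<open>f\<close>; \<open>Lim\<close> is
  unspecified where there is no limit.\<close>

definition bohr_coeff :: "(real ^ 'n \<Rightarrow> complex) \<Rightarrow> real ^ 'n \<Rightarrow> complex" where
  "bohr_coeff f l = Lim at_top (\<lambda>T::real.
     complex_of_real (1 / (2 * T) ^ CARD('n)) *
     integral (cbox (\<chi> i. - T) (\<chi> i. T))
       (\<lambda>x. exp (- \<i> * complex_of_real (l \<bullet> x)) * f x))"

definition bohr_spectrum :: "(real ^ 'n \<Rightarrow> complex) \<Rightarrow> (real ^ 'n) set" where
  "bohr_spectrum f = {l. bohr_coeff f l \<noteq> 0}"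

definition APW :: "(real ^ 'n \<Rightarrow> complex) set" where
  "APW = {f \<in> AP. (\<lambda>l. norm (bohr_coeff f l)) summable_on bohr_spectrum f}"

definition AP_on :: "(real ^ 'n) set \<Rightarrow> (real ^ 'n \<Rightarrow> complex) set" where
  "AP_on D = {f \<in> AP. bohr_spectrum f \<subseteq> D}"

definition APW_on :: "(real ^ 'n) set \<Rightarrow> (real ^ 'n \<Rightarrow> complex) set" where
  "APW_on D = {f \<in> APW. bohr_spectrum f \<subseteq> D}"

definition function_ring :: "('a \<Rightarrow> complex) set \<Rightarrow> ('a \<Rightarrow> complex) ring" where
  "function_ring A =
     \<lparr> carrier = A,
       mult = (\<lambda>f g x. f x * g x),
       one = (\<lambda>x. 1),
       zero = (\<lambda>x. 0),
       add = (\<lambda>f g x. f x + g x) \<rparr>"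

definition halfspace :: "(real ^ 'n) set \<Rightarrow> bool" where
  "halfspace S \<longleftrightarrow>
     S \<union> uminus ` S = UNIV \<and>
     S \<inter> uminus ` S = {0} \<and>
     (\<forall>l\<in>S. \<forall>m\<in>S. l + m \<in> S) \<and>
     (\<forall>l\<in>S. \<forall>a::real. a \<ge> 0 \<longrightarrow> a *\<^sub>R l \<in> S)"

text \<open>Rows and matrices are functions of indices below \<open>m\<close>, counted from 0; their values at
  other indices are irrelevant.\<close>

definition hermite_ring :: "('a, 'b) ring_scheme \<Rightarrow> bool" where
  "hermite_ring R \<longleftrightarrow> cring R \<and>
     (\<forall>m\<ge>1. \<forall>a :: nat \<Rightarrow> 'a.
        (\<forall>i<m. a i \<in> carrier R) \<and>
        (\<exists>b. (\<forall>i<m. b i \<in> carrier R) \<and>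
             (\<Oplus>\<^bsub>R\<^esub>i\<in>{..<m}. a i \<otimes>\<^bsub>R\<^esub> b i) = \<one>\<^bsub>R\<^esub>) \<longrightarrow>
        (\<exists>F G :: nat \<Rightarrow> nat \<Rightarrow> 'a.
           (\<forall>i<m. \<forall>j<m. F i j \<in> carrier R \<and> G i j \<in> carrier R) \<and>
           (\<forall>j<m. F 0 j = a j) \<and>
           (\<forall>i<m. \<forall>j<m. (\<Oplus>\<^bsub>R\<^esub>l\<in>{..<m}. F i l \<otimes>\<^bsub>R\<^esub> G l j) =
              (if i = j then \<one>\<^bsub>R\<^esub> else \<zero>\<^bsub>R\<^esub>))))"

lemma AP_continuous: "f \<in> AP \<Longrightarrow> continuous_on UNIV f"
proof (induction rule: AP.induct)
  case (AP_expo l)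
  show ?case unfolding expo_def by (intro continuous_intros)
next
  case (AP_limit F f)
  show ?case
    by (rule uniform_limit_theorem[where F = sequentially and f = F]) (use AP_limit in auto)
qed (auto intro!: continuous_intros)

lemma AE_bound_iff_bound:
  fixes f :: "real ^ 'n \<Rightarrow> complex"
  assumes "continuous_on UNIV f"
  shows "(AE x in lborel. norm (f x) \<le> c) \<longleftrightarrow> (\<forall>x. norm (f x) \<le> c)"
proof
  assume ae: "AE x in lborel. norm (f x) \<le> c"
  let ?U = "{x. c < norm (f x)}"
  have op: "open ?U"
    using assms by (intro open_Collect_less continuous_intros)
  have "?U \<in> null_sets lborel"
    using ae op by (auto simp: AE_iff_null not_le)
  then have "?U \<in> null_sets lebesgue"
    by (rule null_sets_completionI)
  then have "negligible ?U"
    by (simp add: negligible_iff_null_sets)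
  then have "?U = {}"
    using op open_not_negligible by blast
  then show "\<forall>x. norm (f x) \<le> c"
    by (auto simp: not_less)
qed auto

text \<open>\<open>AP\<close> is closed in the essential supremum norm, up to modification on null sets.\<close>

lemma Linf_limit_AP:
  fixes g :: "real ^ 'n \<Rightarrow> complex" and F :: "nat \<Rightarrow> real ^ 'n \<Rightarrow> complex"
  assumes F: "\<And>n. F n \<in> AP"
    and lim: "\<And>e. e > 0 \<Longrightarrow> \<forall>\<^sub>F n in sequentially. AE x in lborel. norm (F n x - g x) \<le> e"
  shows "\<exists>f\<in>AP. AE x in lborel. f x = g x"
proof -
  have "uniformly_Cauchy_on UNIV F"
  proof (rule uniformly_Cauchy_onI)
    fix e :: real assume e: "e > 0"
    then obtain N where N: "\<And>n. n \<ge> N \<Longrightarrow> AE x in lborel. norm (F n x - g x) \<le> e / 3"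
      using lim[of "e / 3"] by (auto simp: eventually_sequentially)
    have "dist (F m x) (F n x) < e" if "m \<ge> N" "n \<ge> N" for m n x
    proof -
      have "AE x in lborel. norm (F m x - F n x) \<le> 2 * e / 3"
        using N[OF that(1)] N[OF that(2)]
      proof eventually_elim
        case (elim x)
        then show ?case
          using norm_triangle_ineq4[of "F m x - g x" "F n x - g x"] by simp
      qed
      moreover have "continuous_on UNIV (\<lambda>x. F m x - F n x)"
        by (intro continuous_intros AP_continuous F)
      ultimately have "norm (F m x - F n x) \<le> 2 * e / 3"
        using AE_bound_iff_bound by blast
      then show ?thesis using e by (simp add: dist_norm)
    qed
    then show "\<exists>M. \<forall>x\<in>UNIV. \<forall>m\<ge>M. \<forall>n\<ge>M. dist (F m x) (F n x) < e"
      by blast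
  qed
  then obtain f where f: "uniform_limit UNIV F f sequentially"
    using Cauchy_uniformly_convergent uniformly_convergent_on_def by blast
  then have "f \<in> AP" using F AP_limit by blast
  have "AE x in lborel. \<forall>k::nat. norm (f x - g x) \<le> 1 / real (Suc k)"
  proof (subst AE_all_countable, rule allI)
    fix k :: nat
    let ?e = "1 / (2 * real (Suc k))"
    have "\<forall>\<^sub>F n in sequentially. (\<forall>x. dist (F n x) (f x) < ?e) \<and>
            (AE x in lborel. norm (F n x - g x) \<le> ?e)"
      using uniform_limitD[OF f, of ?e] lim[of ?e] by (simp add: eventually_conj)
    then obtain n where n: "\<And>x. dist (F n x) (f x) < ?e"
        "AE x in lborel. norm (F n x - g x) \<le> ?e"
      using eventually_happens by fastforce
    show "AE x in lborel. norm (f x - g x) \<le> 1 / real (Suc k)"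
      using n(2)
    proof eventually_elim
      case (elim x)
      have "norm (f x - g x) \<le> dist (F n x) (f x) + norm (F n x - g x)"
        using norm_triangle_ineq4[of "F n x - g x" "F n x - f x"] by (simp add: dist_norm)
      also have "\<dots> \<le> ?e + ?e" using n(1)[of x] elim by linarith
      also have "\<dots> = 1 / real (Suc k)" by (simp add: field_simps)
      finally show ?case .
    qed
  qed
  then have "AE x in lborel. f x = g x"
  proof eventually_elim
    case (elim x)
    show ?case
    proof (rule ccontr)
      assume "f x \<noteq> g x"
      then obtain k where "1 / real (Suc k) < norm (f x - g x)"
        using nat_approx_posE[of "norm (f x - g x)"] by auto
      then show False using elim by (meson not_le)
    qed
  qed
  with \<open>f \<in> AP\<close> show ?thesis by blast
qed

end

theory Submission
  imports Defs
begin

text \<open>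
  Completing a unimodular row is a property that does not change under deformation, and
  a row over one of these algebras can be deformed to a row of constants.

  If two rows \<open>a\<close> and \<open>a'\<close> share a column \<open>b\<close> for which both \<open>a b\<close> and \<open>a' b\<close> are units, then
  \<open>a\<close> is, up to a unit, the image of \<open>a'\<close> under a rank-one perturbation of the identity whose
  inverse is explicit; hence \<open>a\<close> can be completed if and only if \<open>a'\<close> can
  (\<open>completable_transfer_unit\<close>). In a Banach algebra a small change of \<open>a\<close> keeps \<open>a b\<close> a unit, so
  rows that are joined by a continuous path of unimodular rows are completable together.

  Approximation therefore allows the row \<open>p\<close>, and a column \<open>q\<close> with \<open>p q\<close> close to 1, to consist of
  exponential sums with frequencies in one finite set \<open>L \<subseteq> H\<close>. As \<open>L\<close> lies in a halfspace,
  some vector \<open>w\<close> has \<open>w \<bullet> l > 0\<close> for all nonzero \<open>l \<in> L\<close> (\<open>halfspace_separation\<close>). Multiplying the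
  coefficient at \<open>l\<close> by \<open>r powr (w \<bullet> l)\<close>, for \<open>r\<close> from 1 down to 0, deforms \<open>p\<close> into the row of its
  constant terms; for an exponential sum this is the passage from \<open>f(x)\<close> to \<open>f(x + i t w)\<close> with
  \<open>r = exp (-t)\<close>. The deformation is multiplicative on sums with these frequencies, and it remains
  to see that it keeps \<open>p q\<close> invertible (\<open>unit_twist\<close>). Write \<open>p q = 1 - v\<close> with \<open>v\<close> bounded by 1/2.
  The power \<open>v ^ n\<close> has only polynomially many frequencies, and each coefficient of it is bounded
  by \<open>2 ^ -n\<close>. The deformation does not enlarge coefficients, so the Neumann series of the deformed
  \<open>v\<close> converges even in the Wiener norm. This argument replaces both the maximum principle and
  Wiener's lemma, and it serves the two algebras alike.

  Exponential sums with frequencies in \<open>H\<close> are dense in \<open>AP_on H\<close> because of Fejer means along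
  Foelner sets (\<open>AP_approx_spectrum\<close>), and the same polynomial growth of the number of frequencies
  provides these sets. In \<open>APW_on H\<close> the partial sums of the Bohr-Fourier series are dense; that
  a function in \<open>APW\<close> is the sum of its series is again a consequence of \<open>AP_approx_spectrum\<close>.
\<close>

section \<open>Means over cubes and Bohr coefficients\<close>

definition cube :: "real \<Rightarrow> (real ^ 'n) set" where
  "cube T = cbox (\<chi> i. - T) (\<chi> i. T)"

definition avg :: "real \<Rightarrow> (real ^ 'n \<Rightarrow> complex) \<Rightarrow> complex" where
  "avg T f = complex_of_real (1 / (2 * T) ^ CARD('n)) * integral (cube T) f"

lemma expo_0 [simp]: "expo 0 x = 1" "expo l 0 = 1"
  by (simp_all add: expo_def)

lemma norm_expo [simp]: "norm (expo l x) = 1"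
  by (simp add: expo_def)

lemma expo_add: "expo (l + m) x = expo l x * expo m x"
  by (simp add: expo_def inner_add_left algebra_simps exp_add)

lemma expo_add_right: "expo l (x + y) = expo l x * expo l y"
  by (simp add: expo_def inner_add_right algebra_simps exp_add)

lemma expo_minus_right: "expo l (- x) = expo (- l) x"
  by (simp add: expo_def)

lemma expo_minus: "expo (- l) x = cnj (expo l x)"
  by (simp add: expo_def exp_cnj)

lemma continuous_on_expo [continuous_intros]:
  "continuous_on X g \<Longrightarrow> continuous_on X (\<lambda>x. expo l (g x))"
  unfolding expo_def by (intro continuous_intros)

lemma integrable_cube: "continuous_on UNIV f \<Longrightarrow> f integrable_on cube T"
  for f :: "real ^ 'n \<Rightarrow> 'a::banach"
  unfolding cube_def by (rule integrable_continuous) (rule continuous_on_subset, auto)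

lemma content_cube: "T \<ge> 0 \<Longrightarrow> measure lborel (cube T :: (real ^ 'n) set) = (2 * T) ^ CARD('n)"
  unfolding cube_def by (subst content_cbox_cart) (auto simp: interval_eq_empty_cart not_less)

lemma avg_add:
  assumes "continuous_on UNIV f" "continuous_on UNIV g"
  shows "avg T (\<lambda>x. f x + g x) = avg T f + avg T g"
  using assms by (simp add: avg_def Henstock_Kurzweil_Integration.integral_add integrable_cube ring_distribs)

lemma avg_cmult: "avg T (\<lambda>x. c * f x) = c * avg T f"
  by (simp add: avg_def)

lemma avg_sum:
  assumes "finite I" "\<And>i. i \<in> I \<Longrightarrow> continuous_on UNIV (f i)"
  shows "avg T (\<lambda>x. \<Sum>i\<in>I. f i x) = (\<Sum>i\<in>I. avg T (f i))"
  using assms by (simp add: avg_def Henstock_Kurzweil_Integration.integral_sum integrable_cube sum_distrib_left)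

lemma avg_1: "T > 0 \<Longrightarrow> avg T (\<lambda>x::real^'n. 1) = 1"
proof -
  assume T: "T > 0"
  have "integral (cube T) (\<lambda>x::real^'n. 1::complex) = of_real ((2 * T) ^ CARD('n))"
    using T content_cube[of T, where 'n = 'n]
    by (simp add: cube_def integral_const scaleR_conv_of_real)
  then show ?thesis
    using T by (simp add: avg_def)
qed

lemma norm_avg_le:
  fixes f :: "real ^ 'n \<Rightarrow> complex"
  assumes f: "continuous_on UNIV f" and g: "continuous_on UNIV g" and T: "T > 0"
    and le: "\<And>x. norm (f x) \<le> g x"
  shows "norm (avg T f) \<le> Re (avg T (\<lambda>x. complex_of_real (g x)))"
proof -
  have "integral (cube T) (\<lambda>x. complex_of_real (g x)) = complex_of_real (integral (cube T) g)"
    using integral_linear[OF integrable_cube[OF g] bounded_linear_of_real, of T]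
    by (simp add: o_def)
  moreover have "norm (integral (cube T) f) \<le> integral (cube T) g"
    by (rule integral_norm_bound_integral) (use assms integrable_cube in auto)
  ultimately show ?thesis
    using T by (simp add: avg_def norm_mult norm_divide norm_power divide_right_mono
        flip: of_real_power of_real_mult)
qed

lemma norm_avg_bound:
  fixes f :: "real ^ 'n \<Rightarrow> complex"
  assumes "continuous_on UNIV f" "T > 0" "\<And>x. norm (f x) \<le> B"
  shows "norm (avg T f) \<le> B"
  using norm_avg_le[OF assms(1) continuous_on_const assms(2,3)] avg_cmult[of T "of_real B" "\<lambda>_::real^'n. 1"]
  avg_1[OF assms(2), where 'n = 'n]
  by simp

lemma integral_superset_diff_le:
  fixes f :: "real ^ 'n \<Rightarrow> complex"
  assumes f: "continuous_on UNIV f" "\<And>x. norm (f x) \<le> 1"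
    and sub: "cbox a b \<subseteq> cbox c d"
  shows "norm (integral (cbox c d) f - integral (cbox a b) f)
    \<le> measure lborel (cbox c d) - measure lborel (cbox a b)"
proof -
  have i: "h integrable_on cbox u v" if "continuous_on UNIV h" for h :: "real ^ 'n \<Rightarrow> 'b::banach" and u v
    by (rule integrable_continuous) (use that continuous_on_subset in blast)
  have r: "(\<lambda>x. if x \<in> cbox a b then h x else 0) integrable_on cbox c d"
    "integral (cbox c d) (\<lambda>x. if x \<in> cbox a b then h x else 0) = integral (cbox a b) h"
    if "continuous_on UNIV h" for h :: "real ^ 'n \<Rightarrow> 'b::banach"
    using that i sub by (simp_all add: integrable_restrict_Int Henstock_Kurzweil_Integration.integral_restrict_Int Int_absorb2)
  have d: "(\<lambda>x. h x - (if x \<in> cbox a b then h x else 0)) integrable_on cbox c d"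
    if "continuous_on UNIV h" for h :: "real ^ 'n \<Rightarrow> 'b::banach"
    by (rule Henstock_Kurzweil_Integration.integrable_diff[OF i[OF that] r(1)[OF that]])
  have 1: "continuous_on UNIV (\<lambda>x::real^'n. 1::real)" by simp
  have "norm (integral (cbox c d) (\<lambda>x. f x - (if x \<in> cbox a b then f x else 0)))
      \<le> integral (cbox c d) (\<lambda>x. 1 - (if x \<in> cbox a b then 1 else 0))"
    by (rule integral_norm_bound_integral)
      (use d[OF f(1)] d[OF 1] f in auto)
  then show ?thesis
    using f 1 by (simp only: Henstock_Kurzweil_Integration.integral_diff i r) simp
qed

text \<open>
  Translation by a vector \<open>h\<close> with \<open>l \<bullet> h = \<pi>\<close> changes the sign of \<open>expo l\<close>. The integral over the
  cube and that over the translated cube are therefore opposite, while they differ only by integrals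
  over thin shells inside a slightly larger cube, whose volume is negligible against that of the cube.
\<close>

lemma avg_expo_tendsto_0:
  fixes l :: "real ^ 'n"
  assumes "l \<noteq> 0"
  shows "((\<lambda>T. avg T (expo l)) \<longlongrightarrow> 0) at_top"
proof -
  let ?k = "CARD('n)"
  define h where "h = (pi / (l \<bullet> l)) *\<^sub>R l"
  define d where "d = norm h"
  have lh: "expo l h = - 1"
    using assms by (simp add: expo_def h_def flip: cis_conv_exp)
  have c: "continuous_on UNIV (expo l)"
    using continuous_on_expo[of UNIV "\<lambda>x. x" l] by simp
  have bound: "norm (avg T (expo l)) \<le> (1 + d / T) ^ ?k - 1" if T: "T > 0" for T
  proof -
    let ?a = "(\<chi> i. - T) :: real ^ 'n" and ?b = "(\<chi> i. T) :: real ^ 'n"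
    have hd: "\<bar>h $ i\<bar> \<le> d" for i
      unfolding d_def by (rule component_le_norm_cart)
    have d0: "d \<ge> 0" by (simp add: d_def)
    have sub: "cbox ?a ?b \<subseteq> (cube (T + d) :: (real ^ 'n) set)"
        "cbox (?a + h) (?b + h) \<subseteq> (cube (T + d) :: (real ^ 'n) set)"
    proof -
      show "cbox ?a ?b \<subseteq> (cube (T + d) :: (real ^ 'n) set)"
      proof
        fix x assume x: "x \<in> cbox ?a ?b"
        have "- (T + d) \<le> x $ i \<and> x $ i \<le> T + d" for i
          using x[unfolded mem_box_cart, rule_format, of i] d0 by simp
        then show "x \<in> cube (T + d)" by (auto simp: cube_def mem_box_cart)
      qed
      show "cbox (?a + h) (?b + h) \<subseteq> (cube (T + d) :: (real ^ 'n) set)"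
      proof
        fix x assume x: "x \<in> cbox (?a + h) (?b + h)"
        have "- (T + d) \<le> x $ i \<and> x $ i \<le> T + d" for i
          using x[unfolded mem_box_cart, rule_format, of i] hd[of i] unfolding vector_add_component vec_lambda_beta by linarith
        then show "x \<in> cube (T + d)" by (auto simp: cube_def mem_box_cart)
      qed
    qed
    have m: "measure lborel (cbox (?a + h) (?b + h)) = measure lborel (cbox ?a ?b)"
      using T by (simp add: content_cbox_if_cart interval_eq_empty_cart)
    have mT: "measure lborel (cbox ?a ?b) = (2 * T) ^ ?k"
      using content_cube[of T, where 'n = 'n] T by (simp add: cube_def)
    have sh: "integral (cbox (?a + h) (?b + h)) (expo l) = - integral (cbox ?a ?b) (expo l)"
      by (simp flip: integral_shift_cbox_plus add: o_def expo_add_right lh)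
    let ?I = "integral (cbox ?a ?b) (expo l)" and ?J = "integral (cube (T + d)) (expo l)"
    let ?D = "(2 * (T + d)) ^ ?k - (2 * T) ^ ?k"
    have "norm (?J - ?I) \<le> ?D" "norm (?J - (- ?I)) \<le> ?D"
      using integral_superset_diff_le[OF c _ sub(1)[unfolded cube_def]]
        integral_superset_diff_le[OF c _ sub(2)[unfolded cube_def]]
        content_cube[of "T + d", where 'n = 'n] T d0
      by (simp_all add: cube_def sh mT m)
    then have "norm (2 * ?I) \<le> 2 * ?D"
      using norm_triangle_ineq4[of "?J - (- ?I)" "?J - ?I"] by (simp add: algebra_simps)
    then have "norm ?I / (2 * T) ^ ?k \<le> ?D / (2 * T) ^ ?k"
      using T by (intro divide_right_mono) (auto simp: norm_mult)
    also have "\<dots> = (1 + d / T) ^ ?k - 1"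
    proof -
      have "(2 * (T + d)) / (2 * T) = 1 + d / T" using T by (simp add: field_simps)
      moreover have "?D / (2 * T) ^ ?k = ((2 * (T + d)) / (2 * T)) ^ ?k - 1"
        unfolding diff_divide_distrib power_divide using T by simp
      ultimately show ?thesis by metis
    qed
    also have "norm ?I / (2 * T) ^ ?k = norm (avg T (expo l))"
      using T by (simp add: avg_def cube_def norm_mult norm_divide norm_power)
    finally show ?thesis .
  qed
  have "((\<lambda>T. (1 + d / T) ^ ?k - 1) \<longlongrightarrow> (1 + 0) ^ ?k - 1) at_top"
    by (intro tendsto_diff tendsto_power tendsto_add tendsto_const
        real_tendsto_divide_at_top[OF tendsto_const filterlim_ident])
  then have "((\<lambda>T. (1 + d / T) ^ ?k - 1) \<longlongrightarrow> 0) at_top"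
    by simp
  moreover have "\<forall>\<^sub>F T in at_top. norm (avg T (expo l)) \<le> (1 + d / T) ^ ?k - 1"
    by (rule eventually_mono[OF eventually_gt_at_top[of 0]]) (rule bound)
  ultimately show ?thesis
    by (rule Lim_null_comparison[rotated])
qed

text \<open>
  Unlike an equation for \<open>bohr_coeff\<close>, this predicate asserts that the defining limit exists.
\<close>

definition has_coeff :: "(real ^ 'n \<Rightarrow> complex) \<Rightarrow> real ^ 'n \<Rightarrow> complex \<Rightarrow> bool" where
  "has_coeff f l c \<longleftrightarrow> ((\<lambda>T. avg T (\<lambda>x. expo (- l) x * f x)) \<longlongrightarrow> c) at_top"

lemma bohr_coeff_eqI: "has_coeff f l c \<Longrightarrow> bohr_coeff f l = c"
  unfolding has_coeff_def bohr_coeff_def avg_def cube_def expo_def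
  by (rule tendsto_Lim) simp_all

lemma has_coeff_expo:
  fixes l m :: "real ^ 'n"
  shows "has_coeff (expo m) l (if l = m then 1 else 0)"
proof -
  have e: "expo (- l) x * expo m x = expo (m - l) x" for x
    using expo_add[of m "- l" x] by (simp add: mult.commute)
  show ?thesis
  proof (cases "l = m")
    case True
    then have "(\<lambda>T. avg T (\<lambda>x. expo (- l) x * expo m x)) = (\<lambda>T. avg T (\<lambda>x::real^'n. 1))"
      using e by simp
    moreover have "((\<lambda>T. avg T (\<lambda>x::real^'n. 1)) \<longlongrightarrow> 1) at_top"
      by (rule tendsto_eventually) (rule eventually_mono[OF eventually_gt_at_top[of 0]], rule avg_1)
    ultimately show ?thesis using True by (simp add: has_coeff_def)
  next
    case False
    then show ?thesis
      using avg_expo_tendsto_0[of "m - l"] by (simp add: has_coeff_def e)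
  qed
qed

lemma has_coeff_cmult: "has_coeff f l c \<Longrightarrow> has_coeff (\<lambda>x. a * f x) l (a * c)"
  unfolding has_coeff_def
  by (simp add: mult.left_commute[of _ a] avg_cmult tendsto_mult_left)

lemma has_coeff_sum:
  assumes "finite I" "\<And>i. i \<in> I \<Longrightarrow> has_coeff (f i) l (c i)"
    "\<And>i. i \<in> I \<Longrightarrow> continuous_on UNIV (f i)"
  shows "has_coeff (\<lambda>x. \<Sum>i\<in>I. f i x) l (\<Sum>i\<in>I. c i)"
proof -
  have "continuous_on UNIV (\<lambda>x. expo (- l) x * f i x)" if "i \<in> I" for i
    using assms(3)[OF that] by (intro continuous_intros)
  then show ?thesis
    unfolding has_coeff_def sum_distrib_left
    using assms by (subst avg_sum) (auto simp: has_coeff_def intro!: tendsto_sum)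
qed

lemma has_coeff_add:
  assumes "has_coeff f l c" "has_coeff g l d" "continuous_on UNIV f" "continuous_on UNIV g"
  shows "has_coeff (\<lambda>x. f x + g x) l (c + d)"
  using assms unfolding has_coeff_def
  by (simp add: ring_distribs avg_add continuous_intros tendsto_add)

lemma norm_coeff_le:
  assumes "has_coeff f l c" "continuous_on UNIV f" "\<And>x. norm (f x) \<le> B"
  shows "norm c \<le> B"
  using assms(1) unfolding has_coeff_def
  by (rule Lim_norm_ubound[rotated])
    (auto intro!: eventually_mono[OF eventually_gt_at_top[of 0]] norm_avg_bound continuous_intros assms
      simp: norm_mult)

text \<open>
  The means over cubes are contractions for the supremum norm, uniformly in the size of the cube, so
  the limit over \<open>n\<close> and the limit over cubes can be interchanged.
\<close>

lemma has_coeff_uniform_limit: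
  assumes f: "\<And>n::nat. continuous_on UNIV (F n)" "\<And>n. has_coeff (F n) l (c n)"
    and lim: "uniform_limit UNIV F f sequentially"
  shows "\<exists>a. c \<longlonglongrightarrow> a \<and> has_coeff f l a"
proof -
  have cf: "continuous_on UNIV f"
    by (rule uniform_limit_theorem[OF _ lim]) (use f in auto)
  have "Cauchy c"
  proof (rule metric_CauchyI)
    fix e :: real assume e: "e > 0"
    then obtain N where N: "\<And>n x. n \<ge> N \<Longrightarrow> dist (F n x) (f x) < e / 4"
      using uniform_limitD[OF lim, of "e / 4"] by (auto simp: eventually_sequentially)
    have "dist (c m) (c n) < e" if "m \<ge> N" "n \<ge> N" for m n
    proof -
      have "has_coeff (\<lambda>x. F m x + (-1) * F n x) l (c m + (-1) * c n)"
        by (intro has_coeff_add has_coeff_cmult f continuous_intros)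
      then have "norm (c m + (-1) * c n) \<le> e / 2"
      proof (rule norm_coeff_le)
        show "norm (F m x + - 1 * F n x) \<le> e / 2" for x
          using dist_triangle_half_l[of "F m x" "f x" "e/2" "F n x"] N[OF that(1), of x] N[OF that(2), of x]
          by (auto simp: dist_norm norm_minus_commute)
      qed (intro continuous_intros f)
      then show ?thesis using e by (simp add: dist_norm)
    qed
    then show "\<exists>M. \<forall>m\<ge>M. \<forall>n\<ge>M. dist (c m) (c n) < e" by blast
  qed
  then obtain a where a: "c \<longlonglongrightarrow> a"
    using Cauchy_convergent convergent_def by blast
  have "uniform_limit {0<..} (\<lambda>n T. avg T (\<lambda>x. expo (- l) x * F n x))
      (\<lambda>T. avg T (\<lambda>x. expo (- l) x * f x)) sequentially"
  proof (rule uniform_limitI)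
    fix e :: real assume e: "e > 0"
    have "\<forall>\<^sub>F n in sequentially. \<forall>x\<in>UNIV. dist (F n x) (f x) < e / 2"
      using uniform_limitD[OF lim, of "e / 2"] e by simp
    then show "\<forall>\<^sub>F n in sequentially. \<forall>T\<in>{0<..}. dist (avg T (\<lambda>x. expo (- l) x * F n x))
        (avg T (\<lambda>x. expo (- l) x * f x)) < e"
    proof eventually_elim
      case (elim n)
      have "dist (avg T (\<lambda>x. expo (- l) x * F n x)) (avg T (\<lambda>x. expo (- l) x * f x)) < e"
        if T: "T > 0" for T
      proof -
        have "avg T (\<lambda>x. expo (- l) x * F n x + (- 1) * (expo (- l) x * f x)) =
          avg T (\<lambda>x. expo (- l) x * F n x) + (- 1) * avg T (\<lambda>x. expo (- l) x * f x)"
          by (subst avg_add) (auto simp only: avg_cmult intro!: continuous_intros f cf)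
        moreover have "norm (avg T (\<lambda>x. expo (- l) x * F n x + (- 1) * (expo (- l) x * f x))) \<le> e / 2"
        proof (rule norm_avg_bound[OF _ T])
          fix x
          have "norm (expo (- l) x * F n x + (- 1) * (expo (- l) x * f x)) = norm (expo (- l) x * (F n x - f x))"
            by (simp add: algebra_simps)
          also have "\<dots> \<le> e / 2" using elim by (simp add: norm_mult dist_norm less_imp_le)
          finally show "norm (expo (- l) x * F n x + (- 1) * (expo (- l) x * f x)) \<le> e / 2" .
        qed (intro continuous_intros f cf)
        ultimately show ?thesis using e by (simp add: dist_norm)
      qed
      then show ?case by auto
    qed
  qed
  then have "((\<lambda>T. avg T (\<lambda>x. expo (- l) x * f x)) \<longlongrightarrow> a) at_top"
    by (rule swap_uniform_limit'[rotated 2])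
      (use f a eventually_gt_at_top[of 0] in \<open>auto simp: has_coeff_def\<close>)
  with a show ?thesis by (auto simp: has_coeff_def)
qed

section \<open>Exponential sums and their uniform closure\<close>

definition trig_poly :: "(real ^ 'n) set \<Rightarrow> (real ^ 'n \<Rightarrow> complex) \<Rightarrow> real ^ 'n \<Rightarrow> complex" where
  "trig_poly L c = (\<lambda>x. \<Sum>l\<in>L. c l * expo l x)"

definition trig :: "(real ^ 'n) set \<Rightarrow> (real ^ 'n \<Rightarrow> complex) set" where
  "trig H = {trig_poly L c | L c. finite L \<and> L \<subseteq> H}"

lemma trig_polyI: "finite L \<Longrightarrow> L \<subseteq> H \<Longrightarrow> trig_poly L c \<in> trig H"
  by (auto simp: trig_def)

lemma trigE:
  assumes "f \<in> trig H"
  obtains L c where "finite L" "L \<subseteq> H" "f = trig_poly L c"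
  using assms by (auto simp: trig_def)

text \<open>
  Products of exponential sums come as families in which a frequency may occur repeatedly;
  collecting equal frequencies brings them back to the normal form \<open>trig_poly\<close>.
\<close>

lemma sum_expo_regroup:
  fixes a :: "'i \<Rightarrow> complex"
  assumes "finite I" "finite M" "l ` I \<subseteq> M"
  shows "(\<Sum>i\<in>I. a i * expo (l i) x) = trig_poly M (\<lambda>m. \<Sum>i\<in>{i \<in> I. l i = m}. a i) x"
proof -
  have "(\<Sum>i\<in>I. a i * expo (l i) x) = (\<Sum>m\<in>M. \<Sum>i\<in>{i \<in> I. l i = m}. a i * expo (l i) x)"
    by (rule sum.group[OF assms, symmetric])
  also have "\<dots> = trig_poly M (\<lambda>m. \<Sum>i\<in>{i \<in> I. l i = m}. a i) x"
    unfolding trig_poly_def by (intro sum.cong refl) (simp add: sum_distrib_right)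
  finally show ?thesis .
qed

lemma trig_sumI:
  assumes "finite I" "l ` I \<subseteq> H"
  shows "(\<lambda>x. \<Sum>i\<in>I. a i * expo (l i) x) \<in> trig H"
  using trig_polyI[of "l ` I" H] assms by (simp add: sum_expo_regroup[of I "l ` I" l])

lemma trig_mono: "H \<subseteq> H' \<Longrightarrow> trig H \<subseteq> trig H'"
  unfolding trig_def by blast

lemma trig_expo: "l \<in> H \<Longrightarrow> expo l \<in> trig H"
  using trig_sumI[of "{l}" "\<lambda>x. x" H "\<lambda>_. 1"] by simp

lemma trig_scale: "f \<in> trig H \<Longrightarrow> (\<lambda>x. a * f x) \<in> trig H"
  by (erule trigE) (use trig_polyI in \<open>auto simp: trig_poly_def sum_distrib_left simp flip: mult.assoc\<close>)

lemma trig_add: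
  assumes "f \<in> trig H" "g \<in> trig H" shows "(\<lambda>x. f x + g x) \<in> trig H"
proof -
  obtain L c M d where *: "finite L" "L \<subseteq> H" "f = trig_poly L c" "finite M" "M \<subseteq> H" "g = trig_poly M d"
    using assms by (metis trigE)
  have "(\<lambda>x. \<Sum>i\<in>L <+> M. case_sum c d i * expo (case_sum (\<lambda>l. l) (\<lambda>m. m) i) x) \<in> trig H"
    using * by (intro trig_sumI) auto
  then show ?thesis using * by (simp add: sum.Plus trig_poly_def)
qed

lemma trig_mult:
  assumes "f \<in> trig H" "g \<in> trig H" "\<And>l m. l \<in> H \<Longrightarrow> m \<in> H \<Longrightarrow> l + m \<in> H"
  shows "(\<lambda>x. f x * g x) \<in> trig H"
proof -
  obtain L c M d where *: "finite L" "L \<subseteq> H" "f = trig_poly L c" "finite M" "M \<subseteq> H" "g = trig_poly M d"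
    using assms by (metis trigE)
  have "(\<lambda>x. \<Sum>i\<in>L \<times> M. (c (fst i) * d (snd i)) * expo (fst i + snd i) x) \<in> trig H"
    using * by (intro trig_sumI) (auto intro!: assms(3))
  also have "(\<lambda>x. \<Sum>i\<in>L \<times> M. (c (fst i) * d (snd i)) * expo (fst i + snd i) x) = (\<lambda>x. f x * g x)"
    using * by (simp add: trig_poly_def sum_product sum.cartesian_product expo_add mult_ac case_prod_beta)
  finally show ?thesis .
qed

text \<open>
  The uniform closure of the exponential sums with frequencies in \<open>H\<close>. It turns out to be \<open>AP_on H\<close>
  (\<open>AP_on_eq_trig_closure\<close>), and in this form the closure properties of \<open>AP_on H\<close> are evident.
\<close>

definition trig_closure :: "(real ^ 'n) set \<Rightarrow> (real ^ 'n \<Rightarrow> complex) set" where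
  "trig_closure H = {f. \<forall>e>0. \<exists>p\<in>trig H. \<forall>x. norm (f x - p x) \<le> e}"

lemma trig_subset_closure: "f \<in> trig H \<Longrightarrow> f \<in> trig_closure H"
  by (auto simp: trig_closure_def intro!: bexI[of _ f])

lemma trig_closureD:
  assumes "f \<in> trig_closure H" "e > 0"
  obtains p where "p \<in> trig H" "\<And>x. norm (f x - p x) \<le> e"
  using assms unfolding trig_closure_def by blast

lemma trig_bounded:
  assumes "p \<in> trig H" shows "\<exists>B\<ge>0. \<forall>x. norm (p x) \<le> B"
proof -
  obtain L c where p: "p = trig_poly L c" using assms by (metis trigE)
  have "norm (p x) \<le> (\<Sum>l\<in>L. norm (c l))" for x
    unfolding p trig_poly_def by (intro sum_norm_le) (simp add: norm_mult)
  then show ?thesis by (metis sum_nonneg norm_ge_zero)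
qed

lemma trig_closure_bounded:
  assumes "f \<in> trig_closure H" shows "\<exists>B\<ge>0. \<forall>x. norm (f x) \<le> B"
proof -
  obtain p where p: "p \<in> trig H" "\<And>x. norm (f x - p x) \<le> 1"
    using trig_closureD[OF assms, of 1] by auto
  obtain B where B: "B \<ge> 0" "\<And>x. norm (p x) \<le> B" using trig_bounded[OF p(1)] by blast
  have "norm (f x) \<le> 1 + B" for x
    using norm_triangle_mono[OF p(2)[of x] B(2)[of x]] by simp
  then show ?thesis using B(1) by (intro exI[of _ "1 + B"]) auto
qed

lemma trig_closure_limit:
  assumes "\<And>e. e > 0 \<Longrightarrow> \<exists>g\<in>trig_closure H. \<forall>x. norm (f x - g x) \<le> e"
  shows "f \<in> trig_closure H"
  unfolding trig_closure_def
proof (intro CollectI allI impI)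
  fix e :: real assume e: "e > 0"
  obtain g where g: "g \<in> trig_closure H" "\<And>x. norm (f x - g x) \<le> e / 2"
    using assms[of "e / 2"] e by auto
  obtain p where p: "p \<in> trig H" "\<And>x. norm (g x - p x) \<le> e / 2"
    using trig_closureD[OF g(1), of "e / 2"] e by auto
  have "norm (f x - p x) \<le> e" for x
    using norm_triangle_mono[OF g(2)[of x] p(2)[of x]] by simp
  then show "\<exists>p\<in>trig H. \<forall>x. norm (f x - p x) \<le> e" using p(1) by blast
qed

lemma trig_closure_add:
  assumes "f \<in> trig_closure H" "g \<in> trig_closure H"
  shows "(\<lambda>x. f x + g x) \<in> trig_closure H"
  unfolding trig_closure_def
proof (intro CollectI allI impI)
  fix e :: real assume e: "e > 0"
  obtain p q where pq: "p \<in> trig H" "\<And>x. norm (f x - p x) \<le> e / 2" "q \<in> trig H" "\<And>x. norm (g x - q x) \<le> e / 2"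
    using trig_closureD[OF assms(1), of "e / 2"] trig_closureD[OF assms(2), of "e / 2"] e by (metis half_gt_zero)
  have "norm (f x + g x - (p x + q x)) \<le> e" for x
    using norm_triangle_mono[OF pq(2)[of x] pq(4)[of x]] by (simp add: add_diff_add)
  then show "\<exists>p\<in>trig H. \<forall>x. norm (f x + g x - p x) \<le> e"
    by (intro bexI[OF _ trig_add[OF pq(1,3)]]) auto
qed

lemma trig_closure_mult:
  assumes f: "f \<in> trig_closure H" and g: "g \<in> trig_closure H"
    and H: "\<And>l m. l \<in> H \<Longrightarrow> m \<in> H \<Longrightarrow> l + m \<in> H"
  shows "(\<lambda>x. f x * g x) \<in> trig_closure H"
  unfolding trig_closure_def
proof (intro CollectI allI impI)
  fix e :: real assume e: "e > 0"
  obtain B where B: "B \<ge> 0" "\<And>x. norm (f x) \<le> B" using trig_closure_bounded[OF f] by blast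
  have pos: "e / (2 * (B + 1)) > 0" using e B by simp
  obtain q where q: "q \<in> trig H" "\<And>x. norm (g x - q x) \<le> e / (2 * (B + 1))"
    using trig_closureD[OF g pos] by blast
  obtain C where C: "C \<ge> 0" "\<And>x. norm (q x) \<le> C" using trig_bounded[OF q(1)] by blast
  have pos': "e / (2 * (C + 1)) > 0" using e C by simp
  obtain p where p: "p \<in> trig H" "\<And>x. norm (f x - p x) \<le> e / (2 * (C + 1))"
    using trig_closureD[OF f pos'] by blast
  have half: "z * (e / (2 * z)) = e / 2" "e / (2 * z) * z = e / 2" if "z \<noteq> 0" for z
    using that by simp_all
  have nz: "B + 1 \<noteq> 0" "C + 1 \<noteq> 0" using B(1) C(1) by linarith+
  have "norm (f x * g x - p x * q x) \<le> e" for x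
  proof -
    have "f x * g x - p x * q x = f x * (g x - q x) + (f x - p x) * q x"
      by (simp add: algebra_simps)
    also have "norm \<dots> \<le> norm (f x) * norm (g x - q x) + norm (f x - p x) * norm (q x)"
      by (metis norm_mult norm_triangle_ineq)
    also have "\<dots> \<le> (B + 1) * (e / (2 * (B + 1))) + e / (2 * (C + 1)) * (C + 1)"
      using B C p(2) q(2) pos pos' by (intro add_mono mult_mono) (auto simp: add_increasing2)
    also have "\<dots> = e" by (simp only: half[OF nz(1)] half[OF nz(2)] field_sum_of_halves)
    finally show ?thesis .
  qed
  then show "\<exists>p\<in>trig H. \<forall>x. norm (f x * g x - p x) \<le> e"
    by (intro bexI[OF _ trig_mult[OF p(1) q(1) H]]) auto
qed

lemma AP_const: "(\<lambda>x. c) \<in> AP"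
  using AP_scale[OF AP_expo[of 0], of c] by simp

lemma AP_sum: "finite I \<Longrightarrow> (\<And>i. i \<in> I \<Longrightarrow> f i \<in> AP) \<Longrightarrow> (\<lambda>x. \<Sum>i\<in>I. f i x) \<in> AP"
  by (induction I rule: finite_induct) (auto intro: AP_add AP_const)

lemma trig_poly_AP: "finite L \<Longrightarrow> trig_poly L c \<in> AP"
  unfolding trig_poly_def by (intro AP_sum AP_scale AP_expo)

lemma trig_AP: "f \<in> trig H \<Longrightarrow> f \<in> AP"
  by (auto simp: trig_def trig_poly_AP)

lemma AP_subset_trig_closure: "f \<in> AP \<Longrightarrow> f \<in> trig_closure UNIV"
proof (induction rule: AP.induct)
  case (AP_expo l)
  show ?case by (intro trig_subset_closure trig_expo) simp
next
  case (AP_scale f c)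
  have "(\<lambda>x. c) \<in> trig_closure UNIV"
    using trig_subset_closure[OF trig_scale[OF trig_expo[of 0 UNIV], of c]] by simp
  from trig_closure_mult[OF this AP_scale.IH] show ?case by simp
next
  case (AP_limit F f)
  show ?case
  proof (rule trig_closure_limit)
    fix e :: real assume "e > 0"
    then obtain n where "\<And>x. dist (F n x) (f x) < e"
      using uniform_limitD[OF AP_limit(2), of e] by (auto simp: eventually_sequentially)
    then show "\<exists>g\<in>trig_closure UNIV. \<forall>x. norm (f x - g x) \<le> e"
      by (intro bexI[OF _ AP_limit.IH[of n]]) (simp add: dist_norm norm_minus_commute less_imp_le)
  qed
qed (auto intro: trig_closure_add trig_closure_mult)

lemma trig_closure_sequence:
  assumes "f \<in> trig_closure H"
  shows "\<exists>p. (\<forall>n. p n \<in> trig H) \<and> uniform_limit UNIV p f sequentially"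
proof -
  have "\<exists>p. p \<in> trig H \<and> (\<forall>x. norm (f x - p x) \<le> inverse (real (Suc n)))" for n
    using trig_closureD[OF assms, of "inverse (real (Suc n))"] by auto
  then obtain p where p: "\<And>n. p n \<in> trig H" "\<And>n x. norm (f x - p n x) \<le> inverse (real (Suc n))"
    by metis
  have "uniform_limit UNIV p f sequentially"
  proof (rule uniform_limitI)
    fix e :: real assume "e > 0"
    then have "\<forall>\<^sub>F n in sequentially. inverse (real (Suc n)) < e"
      using LIMSEQ_inverse_real_of_nat order_tendstoD(2) by blast
    then show "\<forall>\<^sub>F n in sequentially. \<forall>x\<in>UNIV. dist (p n x) (f x) < e"
      by eventually_elim (metis p(2) dist_norm norm_minus_commute order_le_less_trans)
  qed
  with p(1) show ?thesis by blast
qed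

lemma trig_closure_AP: "f \<in> trig_closure H \<Longrightarrow> f \<in> AP"
  using trig_closure_sequence[of f H] AP_limit trig_AP by blast

lemma AP_approx_trig:
  assumes "f \<in> AP" "e > 0"
  shows "\<exists>p\<in>trig UNIV. \<forall>x. norm (f x - p x) \<le> e"
  using trig_closureD[OF AP_subset_trig_closure[OF assms(1)] assms(2)] by blast

lemma AP_bounded: "f \<in> AP \<Longrightarrow> \<exists>B\<ge>0. \<forall>x. norm (f x) \<le> B"
  by (rule trig_closure_bounded[OF AP_subset_trig_closure])

lemma has_coeff_trig_poly:
  assumes "finite L"
  shows "has_coeff (trig_poly L c) l (if l \<in> L then c l else 0)"
proof -
  have "has_coeff (trig_poly L c) l (\<Sum>m\<in>L. c m * (if l = m then 1 else 0))"
    unfolding trig_poly_def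
    by (intro has_coeff_sum has_coeff_cmult has_coeff_expo assms continuous_intros)
  then show ?thesis using assms by (simp add: if_distrib[of "(*) _"] cong: if_cong)
qed

lemma bohr_coeff_trig_poly: "finite L \<Longrightarrow> bohr_coeff (trig_poly L c) l = (if l \<in> L then c l else 0)"
  by (rule bohr_coeff_eqI[OF has_coeff_trig_poly])

text \<open>
  The coefficients exist for exponential sums by computation, and existence passes to uniform limits.
\<close>

lemma AP_has_coeff:
  assumes "f \<in> AP" shows "has_coeff f l (bohr_coeff f l)"
proof -
  obtain p where p: "\<forall>n. p n \<in> trig UNIV" and lim: "uniform_limit UNIV p f sequentially"
    using trig_closure_sequence[OF AP_subset_trig_closure[OF assms]] by blast
  have "has_coeff (p n) l (bohr_coeff (p n) l)" for n
    using p[rule_format, of n] by (auto elim!: trigE simp: bohr_coeff_trig_poly has_coeff_trig_poly simp del: if_split)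
  moreover have "continuous_on UNIV (p n)" for n
    using p AP_continuous trig_AP by blast
  ultimately obtain a where "has_coeff f l a"
    using has_coeff_uniform_limit[of p l "\<lambda>n. bohr_coeff (p n) l" f] lim by blast
  then show ?thesis by (simp add: bohr_coeff_eqI)
qed

lemma bohr_coeff_add: "f \<in> AP \<Longrightarrow> g \<in> AP \<Longrightarrow> bohr_coeff (\<lambda>x. f x + g x) l = bohr_coeff f l + bohr_coeff g l"
  by (intro bohr_coeff_eqI has_coeff_add AP_has_coeff AP_continuous)

lemma bohr_coeff_cmult: "f \<in> AP \<Longrightarrow> bohr_coeff (\<lambda>x. a * f x) l = a * bohr_coeff f l"
  by (intro bohr_coeff_eqI has_coeff_cmult AP_has_coeff)

lemma norm_bohr_coeff_le: "f \<in> AP \<Longrightarrow> (\<And>x. norm (f x) \<le> B) \<Longrightarrow> norm (bohr_coeff f l) \<le> B"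
  by (rule norm_coeff_le[OF AP_has_coeff AP_continuous])

section \<open>Foelner sets and Fejer means\<close>

text \<open>
  Sums of elements of \<open>L\<close> in which every element is used at most \<open>n\<close> times. For finite \<open>L\<close> there are at
  most \<open>(n + 1) ^ card L\<close> of them. This polynomial growth yields the Foelner sets below,
  and later it bounds the number of frequencies of an \<open>n\<close>-th power.
\<close>

definition box_sums :: "'a::real_vector set \<Rightarrow> nat \<Rightarrow> 'a set" where
  "box_sums L n = (\<lambda>k. \<Sum>l\<in>L. real (k l) *\<^sub>R l) ` (L \<rightarrow>\<^sub>E {..n})"

lemma finite_box_sums: "finite L \<Longrightarrow> finite (box_sums L n)"
  by (simp add: box_sums_def finite_PiE)

lemma card_box_sums_le: "finite L \<Longrightarrow> card (box_sums L n) \<le> (n + 1) ^ card L"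
  unfolding box_sums_def
  by (rule order_trans[OF card_image_le]) (auto simp: finite_PiE card_PiE)

lemma box_sums_0: "box_sums L 0 = {0}"
proof
  show "box_sums L 0 \<subseteq> {0}"
    by (auto simp: box_sums_def PiE_def Pi_def)
  show "{0} \<subseteq> box_sums L 0"
    by (auto simp: box_sums_def intro!: image_eqI[of _ _ "restrict (\<lambda>_. 0) L"])
qed

lemma box_sums_mono: "m \<le> n \<Longrightarrow> box_sums L m \<subseteq> box_sums L n"
  unfolding box_sums_def by (intro image_mono PiE_mono) auto

lemma box_sums_add:
  assumes "finite L" "l \<in> L" "m \<in> box_sums L n"
  shows "l + m \<in> box_sums L (Suc n)"
proof -
  obtain k where k: "k \<in> L \<rightarrow>\<^sub>E {..n}" "m = (\<Sum>j\<in>L. real (k j) *\<^sub>R j)"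
    using assms(3) by (auto simp: box_sums_def)
  have "(\<Sum>j\<in>L. real ((k(l := Suc (k l))) j) *\<^sub>R j) = (\<Sum>j\<in>L. (if j = l then j else 0) + real (k j) *\<^sub>R j)"
    by (intro sum.cong) (auto simp: algebra_simps)
  also have "\<dots> = l + m"
    using assms k by (simp add: sum.distrib)
  finally have "l + m = (\<Sum>j\<in>L. real ((k(l := Suc (k l))) j) *\<^sub>R j)" ..
  moreover have "k(l := Suc (k l)) \<in> L \<rightarrow>\<^sub>E {..Suc n}"
    using k(1) assms(2) by (auto simp: PiE_iff extensional_def intro: le_SucI)
  ultimately show ?thesis unfolding box_sums_def by (rule image_eqI)
qed

lemma box_sums_subset:
  assumes "finite L" "L \<subseteq> H" "0 \<in> H" "\<And>l m. l \<in> H \<Longrightarrow> m \<in> H \<Longrightarrow> l + m \<in> H"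
  shows "box_sums L n \<subseteq> H"
proof -
  have mult: "real k *\<^sub>R l \<in> H" if "l \<in> H" for k l
    by (induction k) (use assms(3,4) that in \<open>auto simp: scaleR_add_left\<close>)
  have "(\<Sum>l\<in>L. real (k l) *\<^sub>R l) \<in> H" for k
    using assms(1,2) by (induction L) (use assms(3,4) mult in auto)
  then show ?thesis by (auto simp: box_sums_def)
qed

lemma summable_poly_geometric:
  fixes q :: real
  assumes "0 \<le> q" "q < 1"
  shows "summable (\<lambda>n. (real n + 1) ^ r * q ^ n)"
proof -
  have "(\<lambda>n. (1 + inverse (real (Suc n))) ^ r * q) \<longlonglongrightarrow> (1 + 0) ^ r * q"
    by (intro tendsto_intros LIMSEQ_inverse_real_of_nat)
  then have "\<forall>\<^sub>F n in sequentially. (1 + inverse (real (Suc n))) ^ r * q < (1 + q) / 2"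
    by (rule order_tendstoD) (use assms in auto)
  then obtain N where N: "\<And>n. n \<ge> N \<Longrightarrow> (1 + inverse (real (Suc n))) ^ r * q < (1 + q) / 2"
    by (auto simp: eventually_sequentially)
  show ?thesis
  proof (rule summable_ratio_test)
    show "(1 + q) / 2 < 1" using assms by simp
    fix n assume n: "n \<ge> N"
    have "real (Suc n) + 1 = (1 + inverse (real (Suc n))) * (real n + 1)"
      by (simp add: field_simps)
    then have "(real (Suc n) + 1) ^ r * q ^ Suc n
        = ((1 + inverse (real (Suc n))) ^ r * q) * ((real n + 1) ^ r * q ^ n)"
      by (simp only: power_mult_distrib power_Suc mult_ac)
    also have "\<dots> \<le> (1 + q) / 2 * ((real n + 1) ^ r * q ^ n)"
      using N[OF n] assms by (intro mult_right_mono) auto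
    finally show "norm ((real (Suc n) + 1) ^ r * q ^ Suc n) \<le> (1 + q) / 2 * norm ((real n + 1) ^ r * q ^ n)"
      using assms by (simp add: abs_mult)
  qed
qed

text \<open>
  Otherwise the sets would grow exponentially.
\<close>

lemma folner_box_sums:
  assumes "finite L" "d > 0"
  shows "\<exists>n. real (card (box_sums L (Suc n))) \<le> (1 + d) * real (card (box_sums L n))"
proof (rule ccontr)
  assume "\<not> ?thesis"
  then have g: "(1 + d) * real (card (box_sums L n)) < real (card (box_sums L (Suc n)))" for n
    by (simp add: not_le)
  have ge: "(1 + d) ^ n \<le> real (card (box_sums L n))" for n
  proof (induction n)
    case (Suc n)
    then have "(1 + d) * (1 + d) ^ n \<le> (1 + d) * real (card (box_sums L n))"
      using assms by (intro mult_left_mono) auto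
    with g[of n] show ?case by simp
  qed (simp add: box_sums_0)
  have le: "real (card (box_sums L n)) \<le> (real n + 1) ^ card L" for n
    using card_box_sums_le[OF assms(1), of n] by (metis of_nat_1 of_nat_add of_nat_le_iff of_nat_power)
  have "1 \<le> (real n + 1) ^ card L * (1 / (1 + d)) ^ n" for n
    using order_trans[OF ge[of n] le[of n]] assms(2) by (simp add: power_divide)
  moreover have "(\<lambda>n. (real n + 1) ^ card L * (1 / (1 + d)) ^ n) \<longlonglongrightarrow> 0"
    using assms(2) by (intro summable_LIMSEQ_zero summable_poly_geometric) auto
  ultimately have "1 \<le> (0::real)"
    by (intro LIMSEQ_le_const) auto
  then show False by simp
qed

text \<open>
  A set \<open>box_sums L n\<close> that grows little in the next step is almost invariant under translation by \<open>L\<close>,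
  since such a translation maps it into \<open>box_sums L (Suc n)\<close>.
\<close>

lemma folner_set:
  fixes L :: "'a::real_vector set"
  assumes "finite L" "d > 0"
  shows "\<exists>F. finite F \<and> F \<noteq> {} \<and> (\<forall>l\<in>L. (1 - d) * real (card F) \<le> real (card {m\<in>F. l + m \<in> F}))"
proof -
  obtain n where n: "real (card (box_sums L (Suc n))) \<le> (1 + d) * real (card (box_sums L n))"
    using folner_box_sums[OF assms] by blast
  let ?F = "box_sums L n" and ?F' = "box_sums L (Suc n)"
  have fin: "finite ?F" "finite ?F'" using finite_box_sums assms by blast+
  have sub: "?F \<subseteq> ?F'" by (rule box_sums_mono) simp
  have "(1 - d) * real (card ?F) \<le> real (card {m\<in>?F. l + m \<in> ?F})" if l: "l \<in> L" for l
  proof -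
    have "(+) l ` {m\<in>?F. l + m \<notin> ?F} \<subseteq> ?F' - ?F"
      using box_sums_add[OF assms(1) l] by auto
    then have "card {m\<in>?F. l + m \<notin> ?F} \<le> card (?F' - ?F)"
      using fin by (intro card_inj_on_le[of "(+) l"]) auto
    also have "\<dots> = card ?F' - card ?F" using fin sub by (simp add: card_Diff_subset)
    finally have 1: "real (card {m\<in>?F. l + m \<notin> ?F}) \<le> d * real (card ?F)"
      using n card_mono[OF fin(2) sub] by (simp add: of_nat_diff algebra_simps)
    have "card ?F = card ({m\<in>?F. l + m \<in> ?F} \<union> {m\<in>?F. l + m \<notin> ?F})"
      by (rule arg_cong[of _ _ card]) auto
    also have "\<dots> = card {m\<in>?F. l + m \<in> ?F} + card {m\<in>?F. l + m \<notin> ?F}"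
      using fin by (intro card_Un_disjoint) auto
    finally show ?thesis using 1 by (simp add: algebra_simps)
  qed
  moreover have "?F \<noteq> {}" using box_sums_mono[of 0 n L] by (auto simp: box_sums_0)
  ultimately show ?thesis using fin by blast
qed

text \<open>
  The convolution, with respect to the mean over cubes, of \<open>f\<close> with the Fejer kernel
  \<open>(norm (\<Sum>m\<in>F. expo m y))\<^sup>2 / card F\<close>, which is nonnegative and has mean 1.
\<close>

definition fejer_mean :: "(real ^ 'n) set \<Rightarrow> (real ^ 'n \<Rightarrow> complex) \<Rightarrow> real ^ 'n \<Rightarrow> complex" where
  "fejer_mean F f x = (\<Sum>(m, n)\<in>F \<times> F. bohr_coeff f (m - n) * expo (m - n) x) / of_nat (card F)"

lemma avg_fejer_kernel:
  assumes "finite F" "f \<in> AP"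
  shows "((\<lambda>T. avg T (\<lambda>y. f y * complex_of_real ((norm (\<Sum>m\<in>F. expo m (x - y)))\<^sup>2)))
    \<longlongrightarrow> of_nat (card F) * fejer_mean F f x) at_top"
proof -
  have sq: "complex_of_real ((norm (\<Sum>m\<in>F. expo m (x - y)))\<^sup>2) = (\<Sum>i\<in>F \<times> F. expo (fst i - snd i) x * expo (- (fst i - snd i)) y)" for y
  proof -
    have "complex_of_real ((norm (\<Sum>m\<in>F. expo m (x - y)))\<^sup>2) = (\<Sum>m\<in>F. expo m (x - y)) * (\<Sum>n\<in>F. expo (- n) (x - y))"
      by (simp only: complex_norm_square expo_minus cnj_sum)
    also have "\<dots> = (\<Sum>i\<in>F \<times> F. expo (fst i) (x - y) * expo (- snd i) (x - y))"
      by (simp add: sum_product sum.cartesian_product case_prod_beta)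
    also have "\<dots> = (\<Sum>i\<in>F \<times> F. expo (fst i - snd i) x * expo (- (fst i - snd i)) y)"
    proof (intro sum.cong refl)
      fix i
      show "expo (fst i) (x - y) * expo (- snd i) (x - y) = expo (fst i - snd i) x * expo (- (fst i - snd i)) y"
        using expo_add[of "fst i" "- snd i" "x - y"] expo_add_right[of "fst i - snd i" x "- y"]
        by (simp add: expo_minus_right)
    qed
    finally show ?thesis .
  qed
  have c: "continuous_on UNIV f" using AP_continuous assms by blast
  have "avg T (\<lambda>y. f y * complex_of_real ((norm (\<Sum>m\<in>F. expo m (x - y)))\<^sup>2)) =
      (\<Sum>i\<in>F \<times> F. expo (fst i - snd i) x * avg T (\<lambda>y. expo (- (fst i - snd i)) y * f y))" for T
  proof -
    have "avg T (\<lambda>y. f y * complex_of_real ((norm (\<Sum>m\<in>F. expo m (x - y)))\<^sup>2)) =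
        (\<Sum>i\<in>F \<times> F. avg T (\<lambda>y. f y * (expo (fst i - snd i) x * expo (- (fst i - snd i)) y)))"
      unfolding sq sum_distrib_left by (intro avg_sum continuous_intros c finite_cartesian_product assms)
    also have "\<dots> = (\<Sum>i\<in>F \<times> F. avg T (\<lambda>y. expo (fst i - snd i) x * (expo (- (fst i - snd i)) y * f y)))"
      by (simp only: mult_ac)
    finally show ?thesis by (simp only: avg_cmult)
  qed
  moreover have "((\<lambda>T. \<Sum>i\<in>F \<times> F. expo (fst i - snd i) x * avg T (\<lambda>y. expo (- (fst i - snd i)) y * f y))
     \<longlongrightarrow> (\<Sum>i\<in>F \<times> F. expo (fst i - snd i) x * bohr_coeff f (fst i - snd i))) at_top"
    by (intro tendsto_sum tendsto_mult tendsto_const AP_has_coeff[OF assms(2), unfolded has_coeff_def])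
  moreover have "of_nat (card F) * fejer_mean F f x = (\<Sum>i\<in>F \<times> F. expo (fst i - snd i) x * bohr_coeff f (fst i - snd i))"
    using assms(1) by (cases "F = {}") (simp_all add: fejer_mean_def case_prod_beta mult.commute)
  ultimately show ?thesis by simp
qed

lemma fejer_mean_1:
  fixes F :: "(real ^ 'n) set"
  assumes "finite F" "F \<noteq> {}"
  shows "fejer_mean F (\<lambda>x. 1) x = 1"
proof -
  have eq: "(\<lambda>x. 1) = trig_poly {0 :: real ^ 'n} (\<lambda>_. 1)" by (simp add: trig_poly_def)
  then have "bohr_coeff (\<lambda>x. 1) l = (if l = 0 then 1 else 0)" for l :: "real ^ 'n"
    using bohr_coeff_trig_poly[of "{0 :: real ^ 'n}" "\<lambda>_. 1" l, folded eq] by simp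
  then have "fejer_mean F (\<lambda>x. 1) x = (\<Sum>m\<in>F. \<Sum>n\<in>F. if m = n then 1 else 0) / of_nat (card F)"
    by (simp add: fejer_mean_def sum.cartesian_product) (intro sum.cong refl disjI2, auto)
  then show ?thesis using assms by simp
qed

text \<open>
  Averaging against a nonnegative kernel of mean 1 does not enlarge the supremum norm.
\<close>

lemma norm_fejer_mean_le:
  assumes F: "finite F" "F \<noteq> {}" and f: "f \<in> AP" "\<And>x. norm (f x) \<le> B"
  shows "norm (fejer_mean F f x) \<le> B"
proof -
  let ?K = "\<lambda>y. (norm (\<Sum>m\<in>F. expo m (x - y)))\<^sup>2"
  have "((\<lambda>T. norm (avg T (\<lambda>y. f y * complex_of_real (?K y)))) \<longlongrightarrow> norm (of_nat (card F) * fejer_mean F f x)) at_top"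
    by (intro tendsto_intros avg_fejer_kernel F f)
  moreover have "((\<lambda>T. B * Re (avg T (\<lambda>y. 1 * complex_of_real (?K y)))) \<longlongrightarrow> B * Re (of_nat (card F) * fejer_mean F (\<lambda>x. 1) x)) at_top"
    by (intro tendsto_intros avg_fejer_kernel F AP_const)
  moreover have "\<forall>\<^sub>F T in at_top. norm (avg T (\<lambda>y. f y * complex_of_real (?K y))) \<le> B * Re (avg T (\<lambda>y. 1 * complex_of_real (?K y)))"
    using eventually_gt_at_top[of 0]
  proof eventually_elim
    case (elim T)
    have "norm (avg T (\<lambda>y. f y * complex_of_real (?K y))) \<le> Re (avg T (\<lambda>y. complex_of_real (B * ?K y)))"
      by (rule norm_avg_le) (use elim f AP_continuous[OF f(1)] in
        \<open>auto intro!: continuous_intros mult_right_mono simp: norm_mult norm_power\<close>)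
    then show ?case using avg_cmult[of T "of_real B" "\<lambda>y. complex_of_real (?K y)"] by simp
  qed
  ultimately have "norm (of_nat (card F) * fejer_mean F f x) \<le> B * Re (of_nat (card F) * fejer_mean F (\<lambda>x. 1) x)"
    by (intro tendsto_le) auto
  then show ?thesis
    using F by (simp add: fejer_mean_1 norm_mult card_gt_0_iff mult.commute[of B])
qed

lemma fejer_mean_trig: "finite F \<Longrightarrow> fejer_mean F f \<in> trig (bohr_spectrum f)"
proof -
  assume F: "finite F"
  let ?I = "{i \<in> F \<times> F. bohr_coeff f (fst i - snd i) \<noteq> 0}"
  have "fejer_mean F f = (\<lambda>x. (1 / of_nat (card F)) * (\<Sum>i\<in>?I. bohr_coeff f (fst i - snd i) * expo (fst i - snd i) x))"
    unfolding fejer_mean_def using F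
    by (auto simp: case_prod_beta fun_eq_iff intro!: arg_cong2[where f = "(/)"] sum.mono_neutral_right)
  also have "\<dots> \<in> trig (bohr_spectrum f)"
    using F by (intro trig_scale trig_sumI) (auto simp: bohr_spectrum_def)
  finally show ?thesis .
qed

text \<open>
  On exponential sums the Fejer mean is a multiplier; its value at \<open>l\<close> is the proportion of \<open>F\<close> that
  translation by \<open>l\<close> leaves inside \<open>F\<close>, which is close to 1 when \<open>F\<close> is a Foelner set for \<open>l\<close>.
\<close>

lemma fejer_mean_trig_poly:
  assumes "finite F" "finite L"
  shows "fejer_mean F (trig_poly L c) x
    = (\<Sum>l\<in>L. c l * (of_nat (card {m\<in>F. l + m \<in> F}) / of_nat (card F)) * expo l x)"
proof -
  let ?I = "{i \<in> F \<times> F. fst i - snd i \<in> L}"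
  have cd: "card {i \<in> ?I. fst i - snd i = l} = card {m\<in>F. l + m \<in> F}" if "l \<in> L" for l
  proof (rule bij_betw_same_card[of snd], rule bij_betwI[where g = "\<lambda>m. (l + m, m)"])
    show "snd \<in> {i \<in> ?I. fst i - snd i = l} \<rightarrow> {m \<in> F. l + m \<in> F}" by (auto simp: algebra_simps)
    show "(\<lambda>m. (l + m, m)) \<in> {m \<in> F. l + m \<in> F} \<rightarrow> {i \<in> ?I. fst i - snd i = l}" using that by auto
  qed auto
  have "(\<Sum>(m, n)\<in>F \<times> F. bohr_coeff (trig_poly L c) (m - n) * expo (m - n) x)
    = (\<Sum>i\<in>?I. c (fst i - snd i) * expo (fst i - snd i) x)"
    unfolding case_prod_beta bohr_coeff_trig_poly[OF assms(2)] fst_conv snd_conv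
    by (rule sum.mono_neutral_cong_right) (use assms in auto)
  also have "\<dots> = (\<Sum>l\<in>L. \<Sum>i\<in>{i \<in> ?I. fst i - snd i = l}. c (fst i - snd i) * expo (fst i - snd i) x)"
    using assms by (intro sum.group[symmetric]) auto
  also have "\<dots> = (\<Sum>l\<in>L. \<Sum>i\<in>{i \<in> ?I. fst i - snd i = l}. c l * expo l x)"
    by (intro sum.cong refl) auto
  also have "\<dots> = (\<Sum>l\<in>L. of_nat (card {m\<in>F. l + m \<in> F}) * (c l * expo l x))"
    by (intro sum.cong refl) (simp only: sum_constant cd)
  finally show ?thesis
    by (simp add: fejer_mean_def sum_divide_distrib mult_ac)
qed

lemma AP_diff: "f \<in> AP \<Longrightarrow> g \<in> AP \<Longrightarrow> (\<lambda>x. f x - g x) \<in> AP"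
  using AP_add[OF _ AP_scale[of g "-1"], of f] by simp

lemma bohr_coeff_diff:
  "f \<in> AP \<Longrightarrow> g \<in> AP \<Longrightarrow> bohr_coeff (\<lambda>x. f x - g x) l = bohr_coeff f l - bohr_coeff g l"
  using bohr_coeff_add[OF _ AP_scale[of g "-1"], of f l] bohr_coeff_cmult[of g "-1" l] by simp

lemma fejer_mean_diff:
  assumes "f \<in> AP" "g \<in> AP"
  shows "fejer_mean F (\<lambda>x. f x - g x) x = fejer_mean F f x - fejer_mean F g x"
  by (simp add: fejer_mean_def case_prod_beta left_diff_distrib sum_subtractf diff_divide_distrib
      bohr_coeff_diff assms)

text \<open>
  Every Fejer mean of \<open>f\<close> is an exponential sum with frequencies in the spectrum of \<open>f\<close>. To make one
  close to \<open>f\<close>, take an exponential sum \<open>p\<close> with arbitrary frequencies close to \<open>f\<close> and a Foelner set for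
  the frequencies of \<open>p\<close>: then the Fejer mean of \<open>p\<close> is close to \<open>p\<close>, and by contractivity the Fejer
  mean of \<open>f\<close> is close to that of \<open>p\<close>.
\<close>

lemma AP_approx_spectrum:
  assumes f: "f \<in> AP" and e: "e > 0"
  shows "\<exists>p\<in>trig (bohr_spectrum f). \<forall>x. norm (f x - p x) \<le> e"
proof -
  obtain p where p: "p \<in> trig UNIV" "\<And>x. norm (f x - p x) \<le> e / 3"
    using AP_approx_trig[OF f, of "e / 3"] e by auto
  then obtain L c where L: "finite L" "p = trig_poly L c" by (metis trigE)
  define C where "C = (\<Sum>l\<in>L. norm (c l)) + 1"
  have C: "C > 0" unfolding C_def by (simp add: add_nonneg_pos sum_nonneg)
  obtain F where F: "finite F" "F \<noteq> {}"
    "\<And>l. l \<in> L \<Longrightarrow> (1 - e / (3 * C)) * real (card F) \<le> real (card {m\<in>F. l + m \<in> F})"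
    using folner_set[OF L(1), of "e / (3 * C)"] e C by auto
  have cF: "card F > 0" using F by (simp add: card_gt_0_iff)
  have smooth: "norm (p x - fejer_mean F p x) \<le> e / 3" for x
  proof -
    let ?k = "\<lambda>l. real (card {m\<in>F. l + m \<in> F}) / real (card F)"
    have k: "\<bar>1 - ?k l\<bar> \<le> e / (3 * C)" if "l \<in> L" for l
    proof -
      have "?k l \<le> 1" using F(1) cF by (simp add: card_mono)
      moreover have "1 - e / (3 * C) \<le> ?k l"
        using F(3)[OF that] cF by (simp add: pos_le_divide_eq)
      ultimately show ?thesis by simp
    qed
    have "p x - fejer_mean F p x = (\<Sum>l\<in>L. c l * complex_of_real (1 - ?k l) * expo l x)"
      using fejer_mean_trig_poly[OF F(1) L(1), of c x]
      by (simp add: L(2) trig_poly_def algebra_simps flip: sum_subtractf)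
    also have "norm \<dots> \<le> (\<Sum>l\<in>L. norm (c l) * (e / (3 * C)))"
      by (intro sum_norm_le) (simp only: norm_mult norm_expo norm_of_real mult_1_right mult_left_mono k norm_ge_zero)
    also have "\<dots> = (C - 1) * (e / (3 * C))" by (simp only: C_def sum_distrib_right add_diff_cancel_right')
    also have "\<dots> \<le> C * (e / (3 * C))" using C e by (intro mult_right_mono) auto
    also have "\<dots> = e / 3" using C by simp
    finally show ?thesis .
  qed
  have "norm (f x - fejer_mean F f x) \<le> e" for x
  proof -
    have "norm (fejer_mean F (\<lambda>x. f x - p x) x) \<le> e / 3"
      using AP_add[OF f AP_scale[OF trig_AP[OF p(1)], of "-1"]] p(2)
      by (intro norm_fejer_mean_le F) auto
    then have 1: "norm (fejer_mean F f x - fejer_mean F p x) \<le> e / 3"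
      using fejer_mean_diff[OF f trig_AP[OF p(1)]] by simp
    have "f x - fejer_mean F f x = (f x - p x) + (p x - fejer_mean F p x) - (fejer_mean F f x - fejer_mean F p x)"
      by simp
    also have "norm \<dots> \<le> (e / 3 + e / 3) + e / 3"
      by (intro order_trans[OF norm_triangle_ineq4] add_mono order_trans[OF norm_triangle_ineq] 1 p(2) smooth)
    finally show ?thesis by simp
  qed
  then show ?thesis using fejer_mean_trig[OF F(1)] by blast
qed


text \<open>
  One inclusion is \<open>AP_approx_spectrum\<close>; for the other, a coefficient outside \<open>H\<close> vanishes for
  the approximating sums, and coefficients depend continuously on the function.
\<close>

lemma AP_on_eq_trig_closure: "AP_on H = trig_closure H"
proof
  show "AP_on H \<subseteq> trig_closure H"
    using AP_approx_spectrum trig_mono unfolding AP_on_def trig_closure_def by blast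
  show "trig_closure H \<subseteq> AP_on H"
  proof
    fix f assume f: "f \<in> trig_closure H"
    then have AP: "f \<in> AP" by (rule trig_closure_AP)
    have "bohr_coeff f l = 0" if "l \<notin> H" for l
    proof -
      have "norm (bohr_coeff f l) \<le> e" if "e > 0" for e
      proof -
        obtain p where p: "p \<in> trig H" "\<And>x. norm (f x - p x) \<le> e"
          using trig_closureD[OF f \<open>e > 0\<close>] by blast
        have "bohr_coeff p l = 0"
          using p(1) \<open>l \<notin> H\<close> by (auto elim!: trigE simp: bohr_coeff_trig_poly)
        moreover have "norm (bohr_coeff (\<lambda>x. f x - p x) l) \<le> e"
          by (intro norm_bohr_coeff_le AP_diff AP trig_AP[OF p(1)] p(2))
        ultimately show ?thesis by (simp add: bohr_coeff_diff AP trig_AP[OF p(1)])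
      qed
      then show ?thesis by (metis dense_ge norm_le_zero_iff)
    qed
    then show "f \<in> AP_on H" using AP by (auto simp: AP_on_def bohr_spectrum_def)
  qed
qed

section \<open>Absolutely convergent exponential series\<close>

definition wiener_norm :: "(real ^ 'n \<Rightarrow> complex) \<Rightarrow> real" where
  "wiener_norm f = (\<Sum>\<^sub>\<infinity>l\<in>bohr_spectrum f. norm (bohr_coeff f l))"

lemma abs_summable_expo:
  fixes a :: "'i \<Rightarrow> complex"
  assumes "(\<lambda>i. norm (a i)) summable_on I"
  shows "(\<lambda>i. a i * expo (l i) x) summable_on I"
  by (rule abs_summable_summable) (use assms in \<open>simp add: norm_mult\<close>)

lemma uniform_limit_expo_sum:
  fixes a :: "'i \<Rightarrow> complex"
  assumes "(\<lambda>i. norm (a i)) summable_on I"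
  shows "uniform_limit UNIV (\<lambda>F x. \<Sum>i\<in>F. a i * expo (l i) x)
    (\<lambda>x. \<Sum>\<^sub>\<infinity>i\<in>I. a i * expo (l i) x) (finite_subsets_at_top I)"
  by (rule Weierstrass_m_test_general[OF _ assms]) (simp add: norm_mult)

lemma AP_uniform_limit_general:
  assumes "\<forall>\<^sub>F i in F. p i \<in> AP" "uniform_limit UNIV p f F" "F \<noteq> bot"
  shows "f \<in> AP"
proof (rule trig_closure_AP[OF trig_closure_limit])
  fix e :: real assume "e > 0"
  then have "\<forall>\<^sub>F i in F. p i \<in> AP \<and> (\<forall>x\<in>UNIV. dist (p i x) (f x) < e)"
    using assms(1) uniform_limitD[OF assms(2)] by (intro eventually_conj)
  then obtain i where "p i \<in> AP" "\<And>x. dist (p i x) (f x) < e"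
    using eventually_happens'[OF assms(3)] by blast
  then show "\<exists>g\<in>trig_closure UNIV. \<forall>x. norm (f x - g x) \<le> e"
    by (intro bexI[OF _ AP_subset_trig_closure[of "p i"]])
      (auto simp: dist_norm norm_minus_commute less_imp_le)
qed

lemma bohr_coeff_uniform_limit_general:
  assumes "\<forall>\<^sub>F i in F. p i \<in> AP" "uniform_limit UNIV p f F" "f \<in> AP"
  shows "((\<lambda>i. bohr_coeff (p i) l) \<longlongrightarrow> bohr_coeff f l) F"
proof (rule tendstoI)
  fix e :: real assume e: "e > 0"
  have "\<forall>\<^sub>F i in F. \<forall>x\<in>UNIV. dist (p i x) (f x) < e / 2"
    using uniform_limitD[OF assms(2), of "e / 2"] e by simp
  then show "\<forall>\<^sub>F i in F. dist (bohr_coeff (p i) l) (bohr_coeff f l) < e"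
    using assms(1)
  proof eventually_elim
    case (elim i)
    have "norm (bohr_coeff (\<lambda>x. p i x - f x) l) \<le> e / 2"
      using elim by (intro norm_bohr_coeff_le AP_diff assms) (auto simp: dist_norm less_imp_le)
    then show ?case using e elim by (simp add: bohr_coeff_diff assms dist_norm)
  qed
qed

lemma AP_expo_sum:
  fixes a :: "'i \<Rightarrow> complex"
  assumes "(\<lambda>i. norm (a i)) summable_on I"
  shows "(\<lambda>x. \<Sum>\<^sub>\<infinity>i\<in>I. a i * expo (l i) x) \<in> AP"
proof (rule AP_uniform_limit_general[OF _ uniform_limit_expo_sum[OF assms]])
  show "\<forall>\<^sub>F F in finite_subsets_at_top I. (\<lambda>x. \<Sum>i\<in>F. a i * expo (l i) x) \<in> AP"
    by (rule eventually_finite_subsets_at_top_weakI) (intro AP_sum AP_scale AP_expo)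
qed simp

lemma bohr_coeff_expo_sum:
  fixes a :: "'i \<Rightarrow> complex"
  assumes a: "(\<lambda>i. norm (a i)) summable_on I"
  shows "bohr_coeff (\<lambda>x. \<Sum>\<^sub>\<infinity>i\<in>I. a i * expo (l i) x) m = (\<Sum>\<^sub>\<infinity>i\<in>{i \<in> I. l i = m}. a i)"
proof -
  let ?b = "\<lambda>i. if l i = m then a i else 0"
  have coeff: "bohr_coeff (\<lambda>x. \<Sum>i\<in>F. a i * expo (l i) x) m = (\<Sum>i\<in>F. ?b i)" if "finite F" for F
  proof -
    have "has_coeff (\<lambda>x. \<Sum>i\<in>F. a i * expo (l i) x) m (\<Sum>i\<in>F. a i * (if m = l i then 1 else 0))"
      by (intro has_coeff_sum that has_coeff_cmult has_coeff_expo continuous_intros)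
    moreover have "(\<Sum>i\<in>F. a i * (if m = l i then 1 else 0)) = (\<Sum>i\<in>F. ?b i)"
      by (intro sum.cong) auto
    ultimately show ?thesis by (simp add: bohr_coeff_eqI)
  qed
  have fin: "\<forall>\<^sub>F F in finite_subsets_at_top I. finite F"
    by (rule eventually_finite_subsets_at_top_weakI) auto
  have "((\<lambda>F. bohr_coeff (\<lambda>x. \<Sum>i\<in>F. a i * expo (l i) x) m)
      \<longlongrightarrow> bohr_coeff (\<lambda>x. \<Sum>\<^sub>\<infinity>i\<in>I. a i * expo (l i) x) m) (finite_subsets_at_top I)"
    by (rule bohr_coeff_uniform_limit_general[OF _ uniform_limit_expo_sum[OF a] AP_expo_sum[OF a]])
      (use fin in eventually_elim, intro AP_sum AP_scale AP_expo)
  then have "((\<lambda>F. \<Sum>i\<in>F. ?b i) \<longlongrightarrow> bohr_coeff (\<lambda>x. \<Sum>\<^sub>\<infinity>i\<in>I. a i * expo (l i) x) m) (finite_subsets_at_top I)"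
    by (rule Lim_transform_eventually) (use fin in eventually_elim, rule coeff)
  then have "(?b has_sum bohr_coeff (\<lambda>x. \<Sum>\<^sub>\<infinity>i\<in>I. a i * expo (l i) x) m) I"
    by (simp add: has_sum_def)
  then have "bohr_coeff (\<lambda>x. \<Sum>\<^sub>\<infinity>i\<in>I. a i * expo (l i) x) m = infsum ?b I"
    by (simp add: infsumI)
  also have "\<dots> = infsum a {i \<in> I. l i = m}"
    by (rule infsum_cong_neutral) auto
  finally show ?thesis .
qed

text \<open>
  The family may repeat frequencies. Summing within each frequency can only decrease the sum of absolute
  values. Sums, products and series of functions in \<open>APW\<close> are all obtained
  from this lemma by rearranging them into one absolutely summable family.
\<close>

lemma wiener_expo_sum:
  fixes a :: "'i \<Rightarrow> complex"
  assumes a: "(\<lambda>i. norm (a i)) summable_on I"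
    and f: "f = (\<lambda>x. \<Sum>\<^sub>\<infinity>i\<in>I. a i * expo (l i) x)"
  shows "f \<in> APW" "wiener_norm f \<le> (\<Sum>\<^sub>\<infinity>i\<in>I. norm (a i))" "bohr_spectrum f \<subseteq> l ` I"
proof -
  let ?J = "\<lambda>m. {i \<in> I. l i = m}"
  have sub: "(\<lambda>i. norm (a i)) summable_on J" if "J \<subseteq> I" for J
    using summable_on_subset_banach[OF a that] .
  have bound: "(\<Sum>m\<in>M. norm (bohr_coeff f m)) \<le> (\<Sum>\<^sub>\<infinity>i\<in>I. norm (a i))" if "finite M" for M
  proof -
    have "(\<Sum>m\<in>M. norm (bohr_coeff f m)) \<le> (\<Sum>m\<in>M. \<Sum>\<^sub>\<infinity>i\<in>?J m. norm (a i))"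
      unfolding f bohr_coeff_expo_sum[OF a] by (intro sum_mono norm_infsum_bound sub) auto
    also have "\<dots> = (\<Sum>\<^sub>\<infinity>i\<in>(\<Union>m\<in>M. ?J m). norm (a i))"
      by (intro sum_infsum that sub) auto
    also have "\<dots> \<le> (\<Sum>\<^sub>\<infinity>i\<in>I. norm (a i))"
      by (intro infsum_mono2 sub) auto
    finally show ?thesis .
  qed
  have s: "(\<lambda>m. norm (bohr_coeff f m)) summable_on bohr_spectrum f"
    by (rule nonneg_bdd_above_summable_on) (auto intro!: bdd_aboveI2 bound)
  then show "f \<in> APW" using AP_expo_sum[OF a] by (simp add: APW_def f)
  show "wiener_norm f \<le> (\<Sum>\<^sub>\<infinity>i\<in>I. norm (a i))"
    unfolding wiener_norm_def by (intro infsum_le_finite_sums s bound)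
  show "bohr_spectrum f \<subseteq> l ` I"
  proof
    fix m assume "m \<in> bohr_spectrum f"
    then have "infsum a (?J m) \<noteq> 0"
      by (simp add: bohr_spectrum_def f bohr_coeff_expo_sum[OF a])
    then have "?J m \<noteq> {}" by (metis infsum_empty)
    then show "m \<in> l ` I" by auto
  qed
qed

text \<open>
  The only exponential sum with empty spectrum is 0, and by \<open>AP_approx_spectrum\<close> sums with spectrum in
  that of \<open>f\<close> approximate \<open>f\<close>.
\<close>

lemma AP_eq_0:
  assumes "f \<in> AP" "\<And>l. bohr_coeff f l = 0"
  shows "f x = 0"
proof -
  have "norm (f x) \<le> e" if "e > 0" for e
  proof -
    have "bohr_spectrum f = {}" using assms(2) by (simp add: bohr_spectrum_def)
    then show ?thesis
      using AP_approx_spectrum[OF assms(1) that] by (auto simp: trig_def trig_poly_def)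
  qed
  then show ?thesis by (meson field_le_epsilon add_0 norm_le_zero_iff dense_ge)
qed

lemma APW_summable: "f \<in> APW \<Longrightarrow> (\<lambda>l. norm (bohr_coeff f l)) summable_on bohr_spectrum f"
  and APW_AP: "f \<in> APW \<Longrightarrow> f \<in> AP"
  by (simp_all add: APW_def)

text \<open>
  Both sides are almost periodic with the same coefficients.
\<close>

lemma APW_expansion:
  assumes "f \<in> APW"
  shows "f = (\<lambda>x. \<Sum>\<^sub>\<infinity>l\<in>bohr_spectrum f. bohr_coeff f l * expo l x)"
proof
  fix x
  let ?g = "\<lambda>x. \<Sum>\<^sub>\<infinity>l\<in>bohr_spectrum f. bohr_coeff f l * expo l x"
  note s = APW_summable[OF assms]
  have "bohr_coeff ?g m = bohr_coeff f m" for m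
  proof -
    have "bohr_coeff ?g m = infsum (bohr_coeff f) {l \<in> bohr_spectrum f. l = m}"
      by (rule bohr_coeff_expo_sum[OF s])
    also have "{l \<in> bohr_spectrum f. l = m} = (if bohr_coeff f m = 0 then {} else {m})"
      by (auto simp: bohr_spectrum_def)
    finally show ?thesis by simp
  qed
  then have "f x - ?g x = 0"
    by (intro AP_eq_0[of "\<lambda>x. f x - ?g x"] AP_diff APW_AP assms AP_expo_sum s)
      (simp add: bohr_coeff_diff APW_AP assms AP_expo_sum s)
  then show "f x = ?g x" by simp
qed

lemma wiener_norm_nonneg: "0 \<le> wiener_norm f"
  unfolding wiener_norm_def by (rule infsum_nonneg) simp

lemma norm_le_wiener_norm:
  assumes "f \<in> APW" shows "norm (f x) \<le> wiener_norm f"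
  using norm_infsum_bound[of "\<lambda>l. bohr_coeff f l * expo l x" "bohr_spectrum f"]
  by (subst APW_expansion[OF assms])
    (simp add: wiener_norm_def norm_mult APW_summable[OF assms])

lemma abs_summable_times:
  fixes a :: "'i \<Rightarrow> complex" and b :: "'j \<Rightarrow> complex"
  assumes "(\<lambda>i. norm (a i)) summable_on I" "(\<lambda>j. norm (b j)) summable_on J"
  shows "(\<lambda>ij. norm (a (fst ij) * b (snd ij))) summable_on I \<times> J"
    and "infsum (\<lambda>ij. a (fst ij) * b (snd ij)) (I \<times> J) = infsum a I * infsum b J"
    and "infsum (\<lambda>ij. norm (a (fst ij) * b (snd ij))) (I \<times> J)
      = infsum (\<lambda>i. norm (a i)) I * infsum (\<lambda>j. norm (b j)) J"
proof -
  show s: "(\<lambda>ij. norm (a (fst ij) * b (snd ij))) summable_on I \<times> J"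
    unfolding Infinite_Sum.abs_summable_on_Sigma_iff
    using assms by (auto simp: norm_mult infsum_cmult_right' infsum_nonneg abs_mult
        intro!: summable_on_cmult_right summable_on_cmult_left)
  show "infsum (\<lambda>ij. a (fst ij) * b (snd ij)) (I \<times> J) = infsum a I * infsum b J"
    using infsum_Sigma_banach[OF abs_summable_summable[OF s]]
    by (simp add: infsum_cmult_right' infsum_cmult_left')
  show "infsum (\<lambda>ij. norm (a (fst ij) * b (snd ij))) (I \<times> J)
      = infsum (\<lambda>i. norm (a i)) I * infsum (\<lambda>j. norm (b j)) J"
    using infsum_Sigma_banach[of "\<lambda>ij. norm (a (fst ij) * b (snd ij))" I "\<lambda>_. J"] s
    by (simp add: norm_mult infsum_cmult_right' infsum_cmult_left' case_prod_beta)
qed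

lemma APW_mult:
  assumes f: "f \<in> APW" and g: "g \<in> APW"
  shows "(\<lambda>x. f x * g x) \<in> APW"
    and "wiener_norm (\<lambda>x. f x * g x) \<le> wiener_norm f * wiener_norm g"
    and "bohr_spectrum (\<lambda>x. f x * g x) \<subseteq> (\<lambda>i. fst i + snd i) ` (bohr_spectrum f \<times> bohr_spectrum g)"
proof -
  let ?I = "bohr_spectrum f \<times> bohr_spectrum g"
  let ?a = "\<lambda>i. bohr_coeff f (fst i) * bohr_coeff g (snd i)"
  note sf = APW_summable[OF f] and sg = APW_summable[OF g]
  have s: "(\<lambda>i. norm (?a i)) summable_on ?I"
    by (rule abs_summable_times(1)[OF sf sg])
  have eq: "(\<lambda>x. f x * g x) = (\<lambda>x. \<Sum>\<^sub>\<infinity>i\<in>?I. ?a i * expo (fst i + snd i) x)"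
  proof
    fix x
    have "f x * g x = (\<Sum>\<^sub>\<infinity>l\<in>bohr_spectrum f. bohr_coeff f l * expo l x) * (\<Sum>\<^sub>\<infinity>m\<in>bohr_spectrum g. bohr_coeff g m * expo m x)"
      using APW_expansion[OF f] APW_expansion[OF g] by metis
    also have "\<dots> = (\<Sum>\<^sub>\<infinity>i\<in>?I. (bohr_coeff f (fst i) * expo (fst i) x) * (bohr_coeff g (snd i) * expo (snd i) x))"
      by (rule abs_summable_times(2)[symmetric]) (use sf sg in \<open>simp_all add: norm_mult\<close>)
    also have "\<dots> = (\<Sum>\<^sub>\<infinity>i\<in>?I. ?a i * expo (fst i + snd i) x)"
      by (intro infsum_cong) (auto simp: expo_add mult_ac)
    finally show "f x * g x = (\<Sum>\<^sub>\<infinity>i\<in>?I. ?a i * expo (fst i + snd i) x)" .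
  qed
  note w = wiener_expo_sum[OF s eq]
  show "(\<lambda>x. f x * g x) \<in> APW" by (rule w(1))
  show "wiener_norm (\<lambda>x. f x * g x) \<le> wiener_norm f * wiener_norm g"
    using w(2) by (simp add: abs_summable_times(3)[OF sf sg] wiener_norm_def)
  show "bohr_spectrum (\<lambda>x. f x * g x) \<subseteq> (\<lambda>i. fst i + snd i) ` (bohr_spectrum f \<times> bohr_spectrum g)"
    using w(3) by (rule order_trans) auto
qed

lemma APW_suminf:
  fixes g :: "nat \<Rightarrow> real ^ 'n \<Rightarrow> complex"
  assumes g: "\<And>n. g n \<in> APW" and s: "summable (\<lambda>n. wiener_norm (g n))"
  shows "(\<lambda>x. \<Sum>n. g n x) \<in> APW"
    and "wiener_norm (\<lambda>x. \<Sum>n. g n x) \<le> (\<Sum>n. wiener_norm (g n))"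
    and "bohr_spectrum (\<lambda>x. \<Sum>n. g n x) \<subseteq> (\<Union>n. bohr_spectrum (g n))"
proof -
  let ?I = "Sigma UNIV (\<lambda>n. bohr_spectrum (g n))"
  let ?a = "\<lambda>i. bohr_coeff (g (fst i)) (snd i)"
  have ws: "(\<lambda>n. wiener_norm (g n)) summable_on UNIV"
    using s by (simp add: summable_on_UNIV_nonneg_real_iff wiener_norm_nonneg)
  have sa: "(\<lambda>i. norm (?a i)) summable_on ?I"
    unfolding Infinite_Sum.abs_summable_on_Sigma_iff
    using ws by (simp add: APW_summable[OF g] wiener_norm_def infsum_nonneg)
  have nrm: "(\<Sum>\<^sub>\<infinity>i\<in>?I. norm (?a i)) = (\<Sum>n. wiener_norm (g n))"
  proof -
    have "(\<Sum>\<^sub>\<infinity>i\<in>?I. norm (?a i)) = (\<Sum>\<^sub>\<infinity>n. wiener_norm (g n))"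
      using infsum_Sigma_banach[OF sa] by (simp add: wiener_norm_def)
    also have "\<dots> = (\<Sum>n. wiener_norm (g n))"
      using has_sum_imp_sums[OF has_sum_infsum[OF ws]] by (simp add: sums_iff)
    finally show ?thesis .
  qed
  have eq: "(\<lambda>x. \<Sum>n. g n x) = (\<lambda>x. \<Sum>\<^sub>\<infinity>i\<in>?I. ?a i * expo (snd i) x)"
  proof
    fix x
    have sx: "(\<lambda>i. ?a i * expo (snd i) x) summable_on ?I"
      by (rule abs_summable_expo) (use sa in simp)
    have "(\<Sum>\<^sub>\<infinity>i\<in>?I. ?a i * expo (snd i) x) = (\<Sum>\<^sub>\<infinity>n. g n x)"
      using infsum_Sigma_banach[OF sx] APW_expansion[OF g] by (simp add: fun_eq_iff)
    also have "\<dots> = (\<Sum>n. g n x)"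
    proof -
      have "(\<lambda>n. norm (g n x)) summable_on UNIV"
        by (rule Infinite_Sum.abs_summable_on_comparison_test'[OF ws]) (simp add: norm_le_wiener_norm g)
      from has_sum_imp_sums[OF has_sum_infsum[OF abs_summable_summable[OF this]]]
      show ?thesis by (simp add: sums_iff)
    qed
    finally show "(\<Sum>n. g n x) = (\<Sum>\<^sub>\<infinity>i\<in>?I. ?a i * expo (snd i) x)" ..
  qed
  note w = wiener_expo_sum[OF sa eq]
  show "(\<lambda>x. \<Sum>n. g n x) \<in> APW" by (rule w(1))
  show "wiener_norm (\<lambda>x. \<Sum>n. g n x) \<le> (\<Sum>n. wiener_norm (g n))"
    using w(2) by (simp add: nrm)
  show "bohr_spectrum (\<lambda>x. \<Sum>n. g n x) \<subseteq> (\<Union>n. bohr_spectrum (g n))"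
    using w(3) by (rule order_trans) auto
qed

lemma wiener_norm_trig_poly:
  assumes "finite L"
  shows "trig_poly L c \<in> APW" "wiener_norm (trig_poly L c) \<le> (\<Sum>l\<in>L. norm (c l))"
    "bohr_spectrum (trig_poly L c) \<subseteq> L"
  using wiener_expo_sum[of c L "trig_poly L c" "\<lambda>l. l"] assms by (simp_all add: trig_poly_def)

section \<open>Completable rows over an algebra of functions\<close>

locale function_algebra =
  fixes A :: "('x \<Rightarrow> complex) set"
  assumes const: "(\<lambda>x. c) \<in> A"
    and add: "f \<in> A \<Longrightarrow> g \<in> A \<Longrightarrow> (\<lambda>x. f x + g x) \<in> A"
    and mult: "f \<in> A \<Longrightarrow> g \<in> A \<Longrightarrow> (\<lambda>x. f x * g x) \<in> A"
begin

lemma uminus: "f \<in> A \<Longrightarrow> (\<lambda>x. - f x) \<in> A"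
  using mult[OF const[of "- 1"], of f] by simp

lemma diff: "f \<in> A \<Longrightarrow> g \<in> A \<Longrightarrow> (\<lambda>x. f x - g x) \<in> A"
  using add[OF _ uminus[of g], of f] by simp

lemma sum: "(\<And>i. i \<in> I \<Longrightarrow> f i \<in> A) \<Longrightarrow> (\<lambda>x. \<Sum>i\<in>I. f i x) \<in> A"
  by (induction I rule: infinite_finite_induct) (auto intro: add const)

lemma power: "f \<in> A \<Longrightarrow> (\<lambda>x. f x ^ n) \<in> A"
  by (induction n) (auto intro: mult const)

definition unit :: "('x \<Rightarrow> complex) \<Rightarrow> bool" where
  "unit u \<longleftrightarrow> u \<in> A \<and> (\<exists>v\<in>A. \<forall>x. u x * v x = 1)"

lemma unit_mult:
  assumes "unit u" "unit v" shows "unit (\<lambda>x. u x * v x)"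
proof -
  obtain u' v' where *: "u \<in> A" "u' \<in> A" "\<And>x. u x * u' x = 1" "v \<in> A" "v' \<in> A" "\<And>x. v x * v' x = 1"
    using assms unfolding unit_def by blast
  have "(u x * v x) * (u' x * v' x) = 1" for x
    using *(3)[of x] *(6)[of x] by (simp add: mult_ac)
  then show ?thesis using * unfolding unit_def by (intro conjI bexI[of _ "\<lambda>x. u' x * v' x"] mult allI)
qed

lemma unit_const: "c \<noteq> 0 \<Longrightarrow> unit (\<lambda>x. c)"
  unfolding unit_def by (intro conjI bexI[of _ "\<lambda>x. 1 / c"] const) auto

definition completable :: "nat \<Rightarrow> (nat \<Rightarrow> 'x \<Rightarrow> complex) \<Rightarrow> bool" where
  "completable m a \<longleftrightarrow> (\<exists>F G. (\<forall>i<m. \<forall>j<m. F i j \<in> A \<and> G i j \<in> A) \<and> (\<forall>j<m. F 0 j = a j) \<and>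
     (\<forall>i<m. \<forall>j<m. \<forall>x. (\<Sum>l<m. F i l x * G l j x) = (if i = j then 1 else 0)))"

lemma completableE:
  assumes "completable m a"
  obtains F G where "\<And>i j. i < m \<Longrightarrow> j < m \<Longrightarrow> F i j \<in> A" "\<And>i j. i < m \<Longrightarrow> j < m \<Longrightarrow> G i j \<in> A"
    "\<And>j. j < m \<Longrightarrow> F 0 j = a j"
    "\<And>i j x. i < m \<Longrightarrow> j < m \<Longrightarrow> (\<Sum>l<m. F i l x * G l j x) = (if i = j then 1 else 0)"
proof -
  obtain F G where *: "\<forall>i<m. \<forall>j<m. F i j \<in> A \<and> G i j \<in> A" "\<forall>j<m. F 0 j = a j"
    "\<forall>i<m. \<forall>j<m. \<forall>x. (\<Sum>l<m. F i l x * G l j x) = (if i = j then 1 else 0)"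
    using assms unfolding completable_def by (elim exE conjE)
  show thesis by (rule that[of F G]) (use * in blast)+
qed

text \<open>
  Let \<open>c = a - a'\<close> as a row. The matrix \<open>1 + b c\<close> maps the row \<open>a'\<close> to \<open>a' + (a' b) c = a\<close>. Since
  \<open>c b = a b - 1\<close>, its inverse is \<open>1 - b c / (a b)\<close> by the Sherman-Morrison formula, and it has entries in
  the algebra because \<open>a b\<close> is a unit. A completion of \<open>a'\<close> multiplied by this matrix is one of \<open>a\<close>.
\<close>

lemma completable_transfer:
  assumes m: "m \<ge> 1"
    and A: "\<And>i. i < m \<Longrightarrow> a i \<in> A" "\<And>i. i < m \<Longrightarrow> a' i \<in> A" "\<And>i. i < m \<Longrightarrow> b i \<in> A"
    and b: "\<And>x. (\<Sum>i<m. a' i x * b i x) = 1" "unit (\<lambda>x. \<Sum>i<m. a i x * b i x)"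
    and a': "completable m a'"
  shows "completable m a"
proof -
  obtain F G where FG: "\<And>i j. i < m \<Longrightarrow> j < m \<Longrightarrow> F i j \<in> A" "\<And>i j. i < m \<Longrightarrow> j < m \<Longrightarrow> G i j \<in> A"
      "\<And>j. j < m \<Longrightarrow> F 0 j = a' j"
      "\<And>i j x. i < m \<Longrightarrow> j < m \<Longrightarrow> (\<Sum>l<m. F i l x * G l j x) = (if i = j then 1 else 0)"
    by (rule completableE[OF a']) (rule that)
  obtain v' where v': "v' \<in> A" "\<And>x. (\<Sum>i<m. a i x * b i x) * v' x = 1"
    using b(2) unfolding unit_def by blast
  define c where "c j x = a j x - a' j x" for j x
  define F' where "F' i j x = F i j x + (\<Sum>l<m. F i l x * b l x) * c j x" for i j x
  define G' where "G' i j x = G i j x - b i x * v' x * (\<Sum>l<m. c l x * G l j x)" for i j x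
  have cA: "c j \<in> A" if "j < m" for j
    unfolding c_def by (intro diff A that)
  have inA: "F' i j \<in> A \<and> G' i j \<in> A" if "i < m" "j < m" for i j
    unfolding F'_def G'_def by (intro conjI add diff mult sum FG A cA v' that) auto
  have row: "F' 0 j = a j" if "j < m" for j
  proof
    fix x
    have "(\<Sum>l<m. F 0 l x * b l x) = (\<Sum>l<m. a' l x * b l x)"
      by (intro sum.cong) (auto simp: FG)
    then show "F' 0 j x = a j x" using that by (simp add: F'_def FG b c_def)
  qed
  have prod: "(\<Sum>l<m. F' i l x * G' l j x) = (if i = j then 1 else 0)" if ij: "i < m" "j < m" for i j x
  proof -
    define f g s where "f = (\<Sum>l<m. F i l x * b l x)" and "g = (\<Sum>l<m. c l x * G l j x)"
      and "s = (\<Sum>l<m. a l x * b l x)"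
    have cb: "(\<Sum>l<m. c l x * b l x) = s - 1"
      using b(1)[of x] by (simp add: c_def s_def left_diff_distrib sum_subtractf)
    have sv: "s * v' x = 1" using v'(2) by (simp add: s_def)
    have "(\<Sum>l<m. F' i l x * G' l j x) = (\<Sum>l<m. F i l x * G l j x - v' x * g * (F i l x * b l x)
        + f * (c l x * G l j x) - f * v' x * g * (c l x * b l x))"
      unfolding F'_def G'_def f_def[symmetric] g_def[symmetric] by (intro sum.cong refl) (simp add: algebra_simps)
    also have "\<dots> = (if i = j then 1 else 0) - v' x * g * f + f * g - f * v' x * g * (s - 1)"
      by (simp add: sum.distrib sum_subtractf FG ij cb flip: sum_distrib_left f_def g_def)
    also have "\<dots> = (if i = j then 1 else 0) + f * g * (1 - s * v' x)"
      by (simp add: algebra_simps)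
    finally show ?thesis by (simp add: sv)
  qed
  show ?thesis unfolding completable_def using inA row prod by blast
qed

text \<open>
  Dividing \<open>b\<close> by the unit \<open>a' b\<close> normalises it. In this form the hypotheses are symmetric in the
  two rows.
\<close>

lemma completable_transfer_unit:
  assumes m: "m \<ge> 1"
    and A: "\<And>i. i < m \<Longrightarrow> a i \<in> A" "\<And>i. i < m \<Longrightarrow> a' i \<in> A" "\<And>i. i < m \<Longrightarrow> b i \<in> A"
    and u: "unit (\<lambda>x. \<Sum>i<m. a i x * b i x)" "unit (\<lambda>x. \<Sum>i<m. a' i x * b i x)"
    and a': "completable m a'"
  shows "completable m a"
proof -
  obtain v where v: "v \<in> A" "\<forall>x. (\<Sum>i<m. a' i x * b i x) * v x = 1"
    using u(2) unfolding unit_def by blast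
  have "unit v"
    unfolding unit_def using v u(2) by (auto simp: unit_def mult.commute[of "v _"] intro!: bexI[of _ "\<lambda>x. \<Sum>i<m. a' i x * b i x"])
  have s: "(\<Sum>i<m. c i x * (b i x * v x)) = (\<Sum>i<m. c i x * b i x) * v x" for c :: "nat \<Rightarrow> 'x \<Rightarrow> complex" and x
    by (simp add: sum_distrib_right mult.assoc)
  show ?thesis
  proof (rule completable_transfer[OF m A(1,2) _ _ _ a', where b = "\<lambda>i x. b i x * v x"])
    show "unit (\<lambda>x. \<Sum>i<m. a i x * (b i x * v x))"
      unfolding s by (rule unit_mult[OF u(1) \<open>unit v\<close>])
  qed (auto simp: s v intro!: mult A v)
qed

text \<open>
  A constant row is compared with the first row of the identity matrix: a column that is 1 at position
  0 and at a position \<open>p\<close> with \<open>c p \<noteq> 0\<close>, and 0 elsewhere, gives units for both rows, provided that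
  \<open>p = 0\<close> is chosen whenever this is possible.
\<close>

lemma completable_const:
  assumes m: "m \<ge> 1" and c: "\<exists>i<m. c i \<noteq> 0"
  shows "completable m (\<lambda>i x. c i)"
proof -
  let ?e = "\<lambda>i (x::'x). if i = 0 then 1 else (0::complex)"
  obtain p where p: "p < m" "c p \<noteq> 0" "c 0 \<noteq> 0 \<Longrightarrow> p = 0"
    using c m by (cases "c 0 = 0") (auto simp: Suc_le_eq)
  let ?b = "\<lambda>i (x::'x). if i = 0 \<or> i = p then 1 else (0::complex)"
  have 0: "0 \<in> {..<m}" using m by auto
  have e: "(\<Sum>i<m. ?e i x * ?b i x) = 1" for x :: 'x
  proof -
    have "(\<Sum>i<m. ?e i x * ?b i x) = (\<Sum>i<m. if i = 0 then 1 else 0)" by (intro sum.cong) auto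
    then show ?thesis using 0 by simp
  qed
  have cb: "(\<Sum>i<m. c i * ?b i x) = c p" for x :: 'x
  proof -
    have "(\<Sum>i<m. c i * ?b i x) = (\<Sum>i<m. if i = p then c p else 0)"
      using p(3) by (intro sum.cong) auto
    then show ?thesis using p(1) by simp
  qed
  have comp: "completable m ?e"
    unfolding completable_def
    by (intro exI[of _ "\<lambda>i j x. if i = j then 1 else 0"])
      (auto simp: const if_distrib[of "\<lambda>z. z * _"] if_distrib[of "(*) _"] fun_eq_iff cong: if_cong)
  show ?thesis
    by (rule completable_transfer[OF m _ _ _ _ _ comp, where b = ?b])
      (use e cb p(2) in \<open>auto simp: const unit_const\<close>)
qed

lemma cring_function_ring: "cring (function_ring A)"
proof (rule cringI)
  show "abelian_group (function_ring A)"
  proof (rule abelian_groupI)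
    show "\<exists>g\<in>carrier (function_ring A). g \<oplus>\<^bsub>function_ring A\<^esub> f = \<zero>\<^bsub>function_ring A\<^esub>"
      if "f \<in> carrier (function_ring A)" for f
      using uminus[of f] that by (intro bexI[of _ "\<lambda>x. - f x"]) (auto simp: function_ring_def)
  qed (auto simp: function_ring_def add const add.assoc add.commute)
  show "Group.comm_monoid (function_ring A)"
    by (rule comm_monoidI) (auto simp: function_ring_def mult const mult_ac)
qed (auto simp: function_ring_def ring_distribs)

lemma finsum_function_ring:
  assumes "finite I" "\<And>i. i \<in> I \<Longrightarrow> f i \<in> A"
  shows "finsum (function_ring A) f I = (\<lambda>x. \<Sum>i\<in>I. f i x)"
proof -
  interpret R: cring "function_ring A" by (rule cring_function_ring)
  show ?thesis using assms
  proof (induction I rule: finite_induct)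
    case empty
    show ?case unfolding R.finsum_empty by (simp add: function_ring_def)
  next
    case (insert i I)
    have "f \<in> I \<rightarrow> carrier (function_ring A)" "f i \<in> carrier (function_ring A)"
      using insert.prems by (auto simp: function_ring_def)
    then have "finsum (function_ring A) f (insert i I) = f i \<oplus>\<^bsub>function_ring A\<^esub> finsum (function_ring A) f I"
      using insert.hyps by (intro R.finsum_insert) auto
    then show ?case using insert by (simp add: function_ring_def)
  qed
qed

lemma hermite_function_ring:
  assumes "\<And>m a b. m \<ge> 1 \<Longrightarrow> (\<And>i. i < m \<Longrightarrow> a i \<in> A) \<Longrightarrow> (\<And>i. i < m \<Longrightarrow> b i \<in> A) \<Longrightarrow>
    (\<And>x. (\<Sum>i<m. a i x * b i x) = 1) \<Longrightarrow> completable m a"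
  shows "hermite_ring (function_ring A)"
  unfolding hermite_ring_def
proof (intro conjI cring_function_ring allI impI, elim conjE exE)
  let ?R = "function_ring A"
  have sel: "carrier ?R = A" "\<And>f g. f \<otimes>\<^bsub>?R\<^esub> g = (\<lambda>x. f x * g x)" "\<one>\<^bsub>?R\<^esub> = (\<lambda>x. 1)" "\<zero>\<^bsub>?R\<^esub> = (\<lambda>x. 0)"
    by (simp_all add: function_ring_def)
  fix m a b
  assume m: "(1::nat) \<le> m" and a: "\<forall>i<m. a i \<in> carrier ?R" and b: "\<forall>i<m. b i \<in> carrier ?R"
    and ab: "(\<Oplus>\<^bsub>?R\<^esub>i\<in>{..<m}. a i \<otimes>\<^bsub>?R\<^esub> b i) = \<one>\<^bsub>?R\<^esub>"
  have aA: "a i \<in> A" and bA: "b i \<in> A" if "i < m" for i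
    using a b that by (auto simp: sel)
  have "(\<lambda>x. \<Sum>i<m. a i x * b i x) = (\<lambda>x. 1)"
    using ab finsum_function_ring[of "{..<m}" "\<lambda>i x. a i x * b i x"] by (simp add: sel mult aA bA)
  then have "completable m a"
    by (intro assms[OF m aA bA]) (auto dest: fun_cong)
  then obtain F G where FG: "\<And>i j. i < m \<Longrightarrow> j < m \<Longrightarrow> F i j \<in> A" "\<And>i j. i < m \<Longrightarrow> j < m \<Longrightarrow> G i j \<in> A"
      "\<And>j. j < m \<Longrightarrow> F 0 j = a j"
      "\<And>i j x. i < m \<Longrightarrow> j < m \<Longrightarrow> (\<Sum>l<m. F i l x * G l j x) = (if i = j then 1 else 0)"
    by (rule completableE) (rule that)
  have "(\<Oplus>\<^bsub>?R\<^esub>l\<in>{..<m}. F i l \<otimes>\<^bsub>?R\<^esub> G l j) = (if i = j then \<one>\<^bsub>?R\<^esub> else \<zero>\<^bsub>?R\<^esub>)"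
    if "i < m" "j < m" for i j
  proof -
    have "(\<Oplus>\<^bsub>?R\<^esub>l\<in>{..<m}. F i l \<otimes>\<^bsub>?R\<^esub> G l j) = (\<lambda>x. \<Sum>l<m. F i l x * G l j x)"
      using FG that by (subst finsum_function_ring) (auto simp: sel mult)
    then show ?thesis using FG(4)[OF that] by (simp add: sel)
  qed
  then show "\<exists>F G. (\<forall>i<m. \<forall>j<m. F i j \<in> carrier ?R \<and> G i j \<in> carrier ?R) \<and> (\<forall>j<m. F 0 j = a j) \<and>
      (\<forall>i<m. \<forall>j<m. (\<Oplus>\<^bsub>?R\<^esub>l\<in>{..<m}. F i l \<otimes>\<^bsub>?R\<^esub> G l j) = (if i = j then \<one>\<^bsub>?R\<^esub> else \<zero>\<^bsub>?R\<^esub>))"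
    using FG by (intro exI[of _ F] exI[of _ G]) (auto simp: sel)
qed

end

section \<open>Multipliers on exponential sums\<close>

text \<open>
  The function \<open>g\<close> arises from \<open>f\<close> by applying the multiplier \<open>\<phi>\<close> to its coefficients. A relation that
  mentions a finite set \<open>L\<close> of frequencies, which need not all occur, keeps track of where the spectra
  of products lie.
\<close>

definition twist :: "(real ^ 'n \<Rightarrow> complex) \<Rightarrow> (real ^ 'n) set \<Rightarrow> (real ^ 'n \<Rightarrow> complex) \<Rightarrow> (real ^ 'n \<Rightarrow> complex) \<Rightarrow> bool" where
  "twist \<phi> L f g \<longleftrightarrow> (\<exists>c. f = trig_poly L c \<and> g = trig_poly L (\<lambda>l. \<phi> l * c l))"

lemma twist_sumI:
  assumes "finite I" "finite M" "l ` I \<subseteq> M"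
  shows "twist \<phi> M (\<lambda>x. \<Sum>i\<in>I. a i * expo (l i) x) (\<lambda>x. \<Sum>i\<in>I. (\<phi> (l i) * a i) * expo (l i) x)"
proof -
  have "(\<Sum>i\<in>{i \<in> I. l i = m}. \<phi> (l i) * a i) = \<phi> m * (\<Sum>i\<in>{i \<in> I. l i = m}. a i)" for m
    unfolding sum_distrib_left by (intro sum.cong) auto
  then show ?thesis
    unfolding twist_def sum_expo_regroup[OF assms]
    by (intro exI[of _ "\<lambda>m. \<Sum>i\<in>{i \<in> I. l i = m}. a i"] conjI refl) simp
qed

text \<open>
  If \<open>\<phi>\<close> is multiplicative on the frequencies involved, then so is the multiplier on functions.
\<close>

lemma twist_mult:
  assumes "twist \<phi> L f f'" "twist \<phi> M g g'" "finite L" "finite M" "finite N"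
    and LM: "\<And>l m. l \<in> L \<Longrightarrow> m \<in> M \<Longrightarrow> l + m \<in> N \<and> \<phi> (l + m) = \<phi> l * \<phi> m"
  shows "twist \<phi> N (\<lambda>x. f x * g x) (\<lambda>x. f' x * g' x)"
proof -
  obtain c d where c: "f = trig_poly L c" "f' = trig_poly L (\<lambda>l. \<phi> l * c l)"
    and d: "g = trig_poly M d" "g' = trig_poly M (\<lambda>l. \<phi> l * d l)"
    using assms(1,2) unfolding twist_def by blast
  have prod: "trig_poly L a x * trig_poly M b x = (\<Sum>i\<in>L \<times> M. (a (fst i) * b (snd i)) * expo (fst i + snd i) x)" for a b x
    by (simp add: trig_poly_def sum_product sum.cartesian_product expo_add mult_ac case_prod_beta)
  have "(\<Sum>i\<in>L \<times> M. ((\<phi> (fst i) * c (fst i)) * (\<phi> (snd i) * d (snd i))) * expo (fst i + snd i) x) =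
      (\<Sum>i\<in>L \<times> M. (\<phi> (fst i + snd i) * (c (fst i) * d (snd i))) * expo (fst i + snd i) x)" for x
    using LM by (intro sum.cong) auto
  then have eq: "(\<lambda>x. f x * g x) = (\<lambda>x. \<Sum>i\<in>L \<times> M. (c (fst i) * d (snd i)) * expo (fst i + snd i) x)"
    "(\<lambda>x. f' x * g' x) = (\<lambda>x. \<Sum>i\<in>L \<times> M. (\<phi> (fst i + snd i) * (c (fst i) * d (snd i))) * expo (fst i + snd i) x)"
    by (simp_all add: c d prod)
  show ?thesis
    unfolding eq by (rule twist_sumI) (use assms LM in auto)
qed

lemma trig_poly_add: "trig_poly L c x + trig_poly L d x = trig_poly L (\<lambda>l. c l + d l) x"
  by (simp add: trig_poly_def sum.distrib ring_distribs)

lemma trig_poly_diff: "trig_poly L c x - trig_poly L d x = trig_poly L (\<lambda>l. c l - d l) x"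
  by (simp add: trig_poly_def sum_subtractf left_diff_distrib)

lemma twist_diff:
  assumes "twist \<phi> L f f'" "twist \<phi> L g g'"
  shows "twist \<phi> L (\<lambda>x. f x - g x) (\<lambda>x. f' x - g' x)"
proof -
  obtain c d where "f = trig_poly L c" "f' = trig_poly L (\<lambda>l. \<phi> l * c l)"
    and "g = trig_poly L d" "g' = trig_poly L (\<lambda>l. \<phi> l * d l)"
    using assms unfolding twist_def by blast
  then show ?thesis
    unfolding twist_def
    by (intro exI[of _ "\<lambda>l. c l - d l"]) (simp add: trig_poly_diff fun_eq_iff right_diff_distrib)
qed

lemma twist_add:
  assumes "twist \<phi> L f f'" "twist \<phi> L g g'"
  shows "twist \<phi> L (\<lambda>x. f x + g x) (\<lambda>x. f' x + g' x)"
proof -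
  obtain c d where "f = trig_poly L c" "f' = trig_poly L (\<lambda>l. \<phi> l * c l)"
    and "g = trig_poly L d" "g' = trig_poly L (\<lambda>l. \<phi> l * d l)"
    using assms unfolding twist_def by blast
  then show ?thesis
    unfolding twist_def
    by (intro exI[of _ "\<lambda>l. c l + d l"]) (simp add: trig_poly_add fun_eq_iff distrib_left)
qed

lemma twist_const:
  assumes "finite L" "0 \<in> L" "\<phi> 0 = 1"
  shows "twist \<phi> L (\<lambda>x. c) (\<lambda>x. c)"
  using twist_sumI[of "{0::nat}" L "\<lambda>_. 0" \<phi> "\<lambda>_. c"] assms by simp

lemma twist_sum:
  assumes "finite I" "\<And>i. i \<in> I \<Longrightarrow> twist \<phi> L (f i) (g i)" "finite L" "0 \<in> L" "\<phi> 0 = 1"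
  shows "twist \<phi> L (\<lambda>x. \<Sum>i\<in>I. f i x) (\<lambda>x. \<Sum>i\<in>I. g i x)"
  using assms(1,2) by (induction I rule: finite_induct) (auto intro!: twist_add twist_const assms(3-5))

lemma twist_power:
  assumes tw: "twist \<phi> L f g" and L: "finite L" "L \<subseteq> K"
    and K: "0 \<in> K" "\<And>l m. l \<in> K \<Longrightarrow> m \<in> K \<Longrightarrow> l + m \<in> K"
    and chi: "\<phi> 0 = 1" "\<And>l m. l \<in> K \<Longrightarrow> m \<in> K \<Longrightarrow> \<phi> (l + m) = \<phi> l * \<phi> m"
  shows "twist \<phi> (box_sums L n) (\<lambda>x. f x ^ n) (\<lambda>x. g x ^ n)"
proof (induction n)
  case 0
  show ?case using twist_const[of "{0}" \<phi> 1] chi(1) by (simp add: box_sums_0)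
next
  case (Suc n)
  have sub: "box_sums L n \<subseteq> K" by (rule box_sums_subset[OF L K])
  have "twist \<phi> (box_sums L (Suc n)) (\<lambda>x. f x * f x ^ n) (\<lambda>x. g x * g x ^ n)"
    by (rule twist_mult[OF tw Suc.IH L(1)])
      (use finite_box_sums[OF L(1)] box_sums_add[OF L(1)] L(2) sub in \<open>auto intro!: chi(2)\<close>)
  then show ?case by simp
qed

section \<open>Invertibility in algebras containing the exponentials\<close>

text \<open>
  What \<open>AP_on H\<close> with the supremum norm and \<open>APW_on H\<close> with the Wiener norm have in common: a normed
  algebra of functions that contains the exponential sums with frequencies in \<open>H\<close> densely. The Wiener
  norm dominates the norm \<open>N\<close>, so that series of exponential sums need only be controlled in the
  Wiener norm. Completeness enters through \<open>suminf_mem\<close>, which is stated with pointwise sums.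
\<close>

locale trig_algebra = function_algebra A for A :: "(real ^ 'n \<Rightarrow> complex) set" +
  fixes H :: "(real ^ 'n) set" and N :: "(real ^ 'n \<Rightarrow> complex) \<Rightarrow> real"
  assumes H_0: "0 \<in> H" and H_add: "l \<in> H \<Longrightarrow> m \<in> H \<Longrightarrow> l + m \<in> H"
    and N_add: "f \<in> A \<Longrightarrow> g \<in> A \<Longrightarrow> N (\<lambda>x. f x + g x) \<le> N f + N g"
    and N_mult: "f \<in> A \<Longrightarrow> g \<in> A \<Longrightarrow> N (\<lambda>x. f x * g x) \<le> N f * N g"
    and norm_le_N: "f \<in> A \<Longrightarrow> norm (f x) \<le> N f"
    and trig_poly_mem: "finite L \<Longrightarrow> L \<subseteq> H \<Longrightarrow> trig_poly L c \<in> A"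
    and N_trig_poly: "finite L \<Longrightarrow> L \<subseteq> H \<Longrightarrow> N (trig_poly L c) \<le> (\<Sum>l\<in>L. norm (c l))"
    and trig_dense: "f \<in> A \<Longrightarrow> e > 0 \<Longrightarrow> \<exists>p\<in>trig H. N (\<lambda>x. f x - p x) \<le> e"
    and suminf_mem: "(\<And>n::nat. F n \<in> A) \<Longrightarrow> summable (\<lambda>n. N (F n)) \<Longrightarrow> (\<lambda>x. \<Sum>n. F n x) \<in> A"
begin

lemma N_nonneg: "f \<in> A \<Longrightarrow> 0 \<le> N f"
  using norm_le_N[of f 0] norm_ge_zero order_trans by blast

lemma N_const: "N (\<lambda>x. c) \<le> norm c"
  using N_trig_poly[of "{0}" "\<lambda>_. c"] H_0 by (simp add: trig_poly_def)

lemma N_sum: "(\<And>i. i \<in> I \<Longrightarrow> f i \<in> A) \<Longrightarrow> N (\<lambda>x. \<Sum>i\<in>I. f i x) \<le> (\<Sum>i\<in>I. N (f i))"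
proof (induction I rule: infinite_finite_induct)
  case (insert i I)
  then show ?case
    using N_add[of "f i" "\<lambda>x. \<Sum>i\<in>I. f i x"] sum[of I f] by fastforce
qed (use N_const[of 0] in auto)

lemma N_power: "f \<in> A \<Longrightarrow> N (\<lambda>x. f x ^ n) \<le> N f ^ n"
proof (induction n)
  case (Suc n)
  have "N (\<lambda>x. f x * f x ^ n) \<le> N f * N (\<lambda>x. f x ^ n)" by (intro N_mult power Suc)
  also have "\<dots> \<le> N f * N f ^ n" using Suc by (intro mult_left_mono N_nonneg)
  finally show ?case by simp
qed (use N_const[of 1] in simp)

text \<open>
  Convergence of the geometric series is assumed instead of \<open>N f < 1\<close>, because \<open>unit_twist\<close> has no
  bound on the norm of \<open>f\<close> itself but only on those of its powers.
\<close>

lemma unit_Neumann: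
  assumes f: "f \<in> A" and s: "summable (\<lambda>n. N (\<lambda>x. f x ^ n))"
  shows "unit (\<lambda>x. 1 - f x)"
proof -
  have lt: "norm (f x) < 1" for x
  proof -
    have "summable (\<lambda>n. f x ^ n)"
      by (rule summable_comparison_test'[OF s, of 0]) (rule norm_le_N, rule power[OF f])
    then show ?thesis by (simp add: summable_geometric_iff)
  qed
  have "(\<lambda>x. \<Sum>n. f x ^ n) \<in> A" by (rule suminf_mem[OF power[OF f] s])
  moreover have "(1 - f x) * (\<Sum>n. f x ^ n) = 1" for x
    using lt[of x] by (subst suminf_geometric) (auto simp: field_simps)
  ultimately show ?thesis
    unfolding unit_def by (intro conjI diff const f bexI[of _ "\<lambda>x. \<Sum>n. f x ^ n"] allI)
qed

lemma unit_near_1: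
  assumes "f \<in> A" "N f < 1" shows "unit (\<lambda>x. 1 - f x)"
  by (rule unit_Neumann[OF assms(1)], rule summable_comparison_test'[OF summable_geometric, of "N f" 0])
    (use assms N_power in \<open>auto simp: N_nonneg power\<close>)

text \<open>
  Every coefficient of \<open>f\<close> is bounded by the supremum of \<open>f\<close>. This crude estimate of the Wiener norm of
  \<open>g\<close> is sharp enough for \<open>unit_twist\<close>, where only the exponential rate of growth matters.
\<close>

lemma N_twist_le:
  assumes tw: "twist \<phi> L f g" and L: "finite L" "L \<subseteq> H"
    and chi: "\<And>l. l \<in> L \<Longrightarrow> norm (\<phi> l) \<le> 1" and B: "\<And>x. norm (f x) \<le> B"
  shows "N g \<le> real (card L) * B"
proof -
  obtain c where c: "f = trig_poly L c" "g = trig_poly L (\<lambda>l. \<phi> l * c l)"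
    using tw unfolding twist_def by blast
  have "B \<ge> 0" using B[of 0] norm_ge_zero order_trans by blast
  have cB: "norm (c l) \<le> B" if "l \<in> L" for l
    using norm_bohr_coeff_le[OF trig_poly_AP[OF L(1), of c], of B l] B L(1) that
    by (simp add: c bohr_coeff_trig_poly)
  have "N g \<le> (\<Sum>l\<in>L. norm (\<phi> l * c l))" unfolding c by (rule N_trig_poly[OF L])
  also have "\<dots> \<le> (\<Sum>l\<in>L. 1 * B)"
    unfolding norm_mult using chi cB \<open>B \<ge> 0\<close> by (intro sum_mono mult_mono) auto
  finally show ?thesis by simp
qed

text \<open>
  The spectral radius argument. The power \<open>f ^ n\<close> is bounded by \<open>q ^ n\<close> and its frequencies lie in
  \<open>box_sums L n\<close>, so \<open>N_twist_le\<close>, applied to it, bounds the norm of \<open>g ^ n\<close> by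
  \<open>(n + 1) ^ card L * q ^ n\<close>, which is summable.
\<close>

lemma unit_twist:
  assumes tw: "twist \<phi> L f g" and L: "finite L" "L \<subseteq> K" and KH: "K \<subseteq> H"
    and K: "0 \<in> K" "\<And>l m. l \<in> K \<Longrightarrow> m \<in> K \<Longrightarrow> l + m \<in> K"
    and chi: "\<phi> 0 = 1" "\<And>l m. l \<in> K \<Longrightarrow> m \<in> K \<Longrightarrow> \<phi> (l + m) = \<phi> l * \<phi> m" "\<And>l. l \<in> K \<Longrightarrow> norm (\<phi> l) \<le> 1"
    and q: "q < 1" "\<And>x. norm (f x) \<le> q"
  shows "unit (\<lambda>x. 1 - g x)"
proof (rule unit_Neumann)
  show gA: "g \<in> A" using tw trig_poly_mem[OF L(1)] L(2) KH unfolding twist_def by blast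
  have q0: "q \<ge> 0" using q(2)[of 0] norm_ge_zero order_trans by blast
  show "summable (\<lambda>n. N (\<lambda>x. g x ^ n))"
  proof (rule summable_comparison_test'[OF summable_poly_geometric[OF q0 q(1), of "card L"], of 0])
    fix n :: nat
    have sub: "box_sums L n \<subseteq> K" by (rule box_sums_subset[OF L K])
    have "N (\<lambda>x. g x ^ n) \<le> real (card (box_sums L n)) * q ^ n"
    proof (rule N_twist_le[OF twist_power[OF tw L K chi(1,2)] finite_box_sums[OF L(1)]])
      show "norm (f x ^ n) \<le> q ^ n" for x
        using q(2) by (simp add: norm_power power_mono)
    qed (use sub KH chi(3) in auto)
    also have "\<dots> \<le> (real n + 1) ^ card L * q ^ n"
    proof (intro mult_right_mono zero_le_power q0)
      show "real (card (box_sums L n)) \<le> (real n + 1) ^ card L"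
        using card_box_sums_le[OF L(1), of n] by (metis of_nat_1 of_nat_add of_nat_le_iff of_nat_power)
    qed
    finally show "norm (N (\<lambda>x. g x ^ n)) \<le> (real n + 1) ^ card L * q ^ n"
      by (simp add: N_nonneg power gA)
  qed
qed

end

section \<open>Deformation of rows to constants\<close>

text \<open>
  The nonzero elements of a halfspace form a convex set: if a convex combination \<open>u x + v y\<close> were 0, then
  \<open>u x = - v y\<close> would lie in \<open>S \<inter> - S\<close>. So the convex hull of finitely many of them is compact and
  avoids 0, and it can be separated strictly from 0.
\<close>

lemma halfspace_separation:
  fixes S :: "(real ^ 'n) set"
  assumes S: "halfspace S" and L: "finite L" "L \<subseteq> S"
  shows "\<exists>w. \<forall>l\<in>L. l \<noteq> 0 \<longrightarrow> w \<bullet> l > 0"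
proof -
  have S0: "S \<inter> uminus ` S = {0}"
    and Sadd: "\<And>l m. l \<in> S \<Longrightarrow> m \<in> S \<Longrightarrow> l + m \<in> S"
    and Sscale: "\<And>l a. l \<in> S \<Longrightarrow> 0 \<le> a \<Longrightarrow> a *\<^sub>R l \<in> S"
    using S unfolding halfspace_def by auto
  have conv: "convex (S - {0})"
  proof (rule convexI)
    fix x y and u v :: real
    assume x: "x \<in> S - {0}" and y: "y \<in> S - {0}" and uv: "0 \<le> u" "0 \<le> v" "u + v = 1"
    have ux: "u *\<^sub>R x \<in> S" and vy: "v *\<^sub>R y \<in> S" using Sscale x y uv by auto
    have "u *\<^sub>R x + v *\<^sub>R y \<noteq> 0"
    proof
      assume 0: "u *\<^sub>R x + v *\<^sub>R y = 0"
      then have "u *\<^sub>R x = - (v *\<^sub>R y)" by (simp add: eq_neg_iff_add_eq_0)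
      then have "u *\<^sub>R x \<in> S \<inter> uminus ` S" using ux vy by auto
      then have "u *\<^sub>R x = 0" using S0 by auto
      with 0 have "u = 0 \<and> v = 0" using x y by auto
      with uv show False by simp
    qed
    then show "u *\<^sub>R x + v *\<^sub>R y \<in> S - {0}" using Sadd[OF ux vy] by simp
  qed
  let ?C = "convex hull (L - {0})"
  have "?C \<subseteq> S - {0}" using L conv by (intro hull_minimal) auto
  moreover have "closed ?C"
    using L by (intro compact_imp_closed compact_convex_hull finite_imp_compact) auto
  ultimately have "\<exists>w b. w \<noteq> 0 \<and> 0 < b \<and> (\<forall>x\<in>?C. w \<bullet> x > b)"
    by (intro separating_hyperplane_closed_0 convex_convex_hull) auto
  then obtain w b where w: "0 < b" "\<forall>x\<in>?C. w \<bullet> x > b" by blast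
  have "w \<bullet> l > 0" if "l \<in> L" "l \<noteq> 0" for l
  proof -
    have "l \<in> ?C" by (rule hull_inc) (use that in simp)
    with w show ?thesis by fastforce
  qed
  then show ?thesis by blast
qed

text \<open>
  The character \<open>l \<mapsto> r powr (w \<bullet> l)\<close> on the frequencies with \<open>w \<bullet> l \<ge> 0\<close>. The case distinction matters at
  \<open>r = 0\<close> only: there the frequencies with \<open>w \<bullet> l = 0\<close> must keep their coefficients, whereas
  \<open>0 powr 0 = 0\<close>.
\<close>

definition decay :: "real ^ 'n \<Rightarrow> real \<Rightarrow> real ^ 'n \<Rightarrow> complex" where
  "decay w r l = complex_of_real (if w \<bullet> l = 0 then 1 else r powr (w \<bullet> l))"

lemma decay_0 [simp]: "decay w r 0 = 1"
  by (simp add: decay_def)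

lemma decay_at_1 [simp]: "decay w 1 l = 1"
  by (simp add: decay_def)

lemma decay_add:
  "0 \<le> w \<bullet> l \<Longrightarrow> 0 \<le> w \<bullet> m \<Longrightarrow> decay w r (l + m) = decay w r l * decay w r m"
  by (auto simp: decay_def inner_add_right powr_add add_nonneg_eq_0_iff)

lemma norm_decay_le: "0 \<le> w \<bullet> l \<Longrightarrow> 0 \<le> r \<Longrightarrow> r \<le> 1 \<Longrightarrow> norm (decay w r l) \<le> 1"
  by (auto simp: decay_def powr_le1)

lemma continuous_on_decay:
  "0 \<le> w \<bullet> l \<Longrightarrow> continuous_on {0..1} (\<lambda>r. decay w r l)"
  by (cases "w \<bullet> l = 0") (auto simp: decay_def intro!: continuous_intros continuous_on_powr')

text \<open>
  Frequencies with coefficient 0 are permitted, so finitely many exponential sums can be written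
  over one finite set.
\<close>

lemma trig_common_spectrum:
  assumes "finite P" "P \<subseteq> trig H" "0 \<in> H"
  shows "\<exists>L. finite L \<and> 0 \<in> L \<and> L \<subseteq> H \<and> (\<forall>f\<in>P. \<exists>c. f = trig_poly L c)"
proof -
  have "\<forall>f\<in>P. \<exists>L c. finite L \<and> L \<subseteq> H \<and> f = trig_poly L c"
  proof
    fix f assume "f \<in> P"
    with assms(2) have "f \<in> trig H" by blast
    then show "\<exists>L c. finite L \<and> L \<subseteq> H \<and> f = trig_poly L c" by (rule trigE) blast
  qed
  then obtain M c where M: "\<And>f. f \<in> P \<Longrightarrow> finite (M f) \<and> M f \<subseteq> H \<and> f = trig_poly (M f) (c f)"
    by metis
  define L where "L = insert 0 (\<Union>f\<in>P. M f)"
  have fin: "finite L" using assms(1) M by (auto simp: L_def)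
  have "f = trig_poly L (\<lambda>l. if l \<in> M f then c f l else 0)" if f: "f \<in> P" for f
  proof
    fix x
    have "f x = (\<Sum>l\<in>M f. c f l * expo l x)" using M[OF f] by (metis trig_poly_def)
    also have "\<dots> = (\<Sum>l\<in>L. (if l \<in> M f then c f l else 0) * expo l x)"
      using fin f by (intro sum.mono_neutral_cong_left) (auto simp: L_def)
    finally show "f x = trig_poly L (\<lambda>l. if l \<in> M f then c f l else 0) x"
      by (simp add: trig_poly_def)
  qed
  then show ?thesis using fin M assms(3) by (intro exI[of _ L]) (auto simp: L_def)
qed

context trig_algebra
begin

lemma trig_mem: "f \<in> trig H \<Longrightarrow> f \<in> A"
  by (auto simp: trig_def trig_poly_mem)

lemma trig_dense_factor:
  assumes "f \<in> A" "g \<in> A" "e > 0"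
  shows "\<exists>p\<in>trig H. N (\<lambda>x. g x * (f x - p x)) \<le> e"
proof -
  have pos: "e / (N g + 1) > 0" using assms(2,3) N_nonneg[of g] by simp
  obtain p where p: "p \<in> trig H" "N (\<lambda>x. f x - p x) \<le> e / (N g + 1)"
    using trig_dense[OF assms(1) pos] by blast
  have "N (\<lambda>x. g x * (f x - p x)) \<le> N g * N (\<lambda>x. f x - p x)"
    by (intro N_mult diff assms trig_mem p)
  also have "\<dots> \<le> (N g + 1) * (e / (N g + 1))"
    using p(2) pos N_nonneg assms(1,2) diff[OF assms(1) trig_mem[OF p(1)]] by (intro mult_mono) auto
  also have "\<dots> = e" using N_nonneg[OF assms(2)] by simp
  finally show ?thesis using p(1) by blast
qed

text \<open>
  With \<open>z\<close> the inverse of \<open>a b\<close>, one has \<open>a' b = (a b) (1 - z (a - a') b)\<close>, and the last factor is a unit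
  when \<open>a'\<close> is close to \<open>a\<close>.
\<close>

lemma completable_near:
  assumes m: "m \<ge> 1"
    and A: "\<And>i. i < m \<Longrightarrow> a i \<in> A" "\<And>i. i < m \<Longrightarrow> a' i \<in> A" "\<And>i. i < m \<Longrightarrow> b i \<in> A"
    and z: "z \<in> A" "\<And>x. (\<Sum>i<m. a i x * b i x) * z x = 1"
    and near: "N z * (\<Sum>i<m. N (\<lambda>x. a i x - a' i x) * N (b i)) < 1"
  shows "completable m a \<longleftrightarrow> completable m a'"
proof -
  let ?u = "\<lambda>x. \<Sum>i<m. a i x * b i x" and ?d = "\<lambda>x. z x * (\<Sum>i<m. (a i x - a' i x) * b i x)"
  have uA: "?u \<in> A" by (intro sum mult A) auto
  have u: "unit ?u" using z uA unfolding unit_def by blast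
  have dA: "(\<lambda>x. (a i x - a' i x) * b i x) \<in> A" if "i < m" for i
    by (intro mult diff A that)
  have "N ?d \<le> N z * N (\<lambda>x. \<Sum>i<m. (a i x - a' i x) * b i x)"
    by (intro N_mult z sum dA) auto
  also have "\<dots> \<le> N z * (\<Sum>i<m. N (\<lambda>x. (a i x - a' i x) * b i x))"
    by (intro mult_left_mono N_sum N_nonneg z dA) auto
  also have "\<dots> \<le> N z * (\<Sum>i<m. N (\<lambda>x. a i x - a' i x) * N (b i))"
    by (intro mult_left_mono sum_mono N_nonneg z N_mult diff A) auto
  finally have "N ?d < 1" using near by simp
  then have "unit (\<lambda>x. 1 - ?d x)"
    by (intro unit_near_1 mult z sum dA) auto
  from unit_mult[OF u this] have "unit (\<lambda>x. ?u x * (1 - ?d x))" .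
  also have "(\<lambda>x. ?u x * (1 - ?d x)) = (\<lambda>x. \<Sum>i<m. a' i x * b i x)"
  proof
    fix x
    have "?u x * (1 - ?d x) = ?u x - (?u x * z x) * (\<Sum>i<m. (a i x - a' i x) * b i x)"
      by (simp add: algebra_simps)
    also have "\<dots> = (\<Sum>i<m. a' i x * b i x)"
      unfolding z(2) by (simp add: left_diff_distrib sum_subtractf)
    finally show "?u x * (1 - ?d x) = (\<Sum>i<m. a' i x * b i x)" .
  qed
  finally have u': "unit (\<lambda>x. \<Sum>i<m. a' i x * b i x)" .
  show ?thesis
    using completable_transfer_unit[of m a a' b, OF m A u u']
      completable_transfer_unit[of m a' a b, OF m A(2,1,3) u' u] by blast
qed

text \<open>
  The row is deformed by the multipliers \<open>decay w r\<close> to its row of constant terms. Completability is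
  locally constant along the way, because the deformed column \<open>Q r\<close> remains an inverse up to a unit, and
  the parameter interval is connected.
\<close>

lemma completable_trig:
  assumes S: "halfspace S" "H \<subseteq> S" and m: "m \<ge> 1"
    and pq: "\<And>i. i < m \<Longrightarrow> p i \<in> trig H" "\<And>i. i < m \<Longrightarrow> q i \<in> trig H"
    and near: "\<And>x. norm (1 - (\<Sum>i<m. p i x * q i x)) \<le> 1 / 2"
  shows "completable m p"
proof -
  have sub: "p ` {..<m} \<union> q ` {..<m} \<subseteq> trig H" using pq by auto
  obtain L where L: "finite L" "0 \<in> L" "L \<subseteq> H"
    and Lpq: "\<forall>f\<in>p ` {..<m} \<union> q ` {..<m}. \<exists>c. f = trig_poly L c"
    using trig_common_spectrum[OF _ sub H_0] by blast
  have "\<exists>c. i < m \<longrightarrow> p i = trig_poly L c" "\<exists>d. i < m \<longrightarrow> q i = trig_poly L d" for i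
    using Lpq by blast+
  then obtain c d where c: "\<And>i. i < m \<longrightarrow> p i = trig_poly L (c i)"
    and d: "\<And>i. i < m \<longrightarrow> q i = trig_poly L (d i)"
    by metis
  note c = c[rule_format] and d = d[rule_format]
  obtain w where w: "\<forall>l\<in>L. l \<noteq> 0 \<longrightarrow> w \<bullet> l > 0"
    using halfspace_separation[OF S(1) L(1) order_trans[OF L(3) S(2)]] by (elim exE)
  \<comment> \<open>The multiplier is a bounded character only on frequencies with nonnegative weight; these
    form a semigroup that contains all products occurring below.\<close>
  define K where "K = {l \<in> H. 0 \<le> w \<bullet> l}"
  have K: "K \<subseteq> H" "0 \<in> K" "\<And>l m. l \<in> K \<Longrightarrow> m \<in> K \<Longrightarrow> l + m \<in> K"
    using H_0 H_add by (auto simp: K_def inner_add_right)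
  have LK: "L \<subseteq> K"
  proof
    fix l assume "l \<in> L"
    with w L(3) show "l \<in> K" by (cases "l = 0") (auto simp: K_def less_imp_le)
  qed
  define P where "P r i = trig_poly L (\<lambda>l. decay w r l * c i l)" for r i
  define Q where "Q r i = trig_poly L (\<lambda>l. decay w r l * d i l)" for r i
  have PA: "P r i \<in> A" and QA: "Q r i \<in> A" for r i
    unfolding P_def Q_def by (intro trig_poly_mem L)+
  have unit: "unit (\<lambda>x. \<Sum>i<m. P r i x * Q r i x)" if r: "r \<in> {0..1}" for r
  proof -
    let ?M = "(\<lambda>i. fst i + snd i) ` (L \<times> L)"
    have M: "finite ?M" "0 \<in> ?M" "?M \<subseteq> K"
      using L LK by (auto intro!: image_eqI[of _ _ "(0, 0)"] K(3))
    have add: "decay w r (l + m) = decay w r l * decay w r m" if "l \<in> K" "m \<in> K" for l m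
      using that by (intro decay_add) (auto simp: K_def)
    have "twist (decay w r) ?M (\<lambda>x. p i x * q i x) (\<lambda>x. P r i x * Q r i x)" if i: "i < m" for i
    proof (rule twist_mult[OF _ _ L(1) L(1) M(1)])
      show "twist (decay w r) L (p i) (P r i)" "twist (decay w r) L (q i) (Q r i)"
        using i c d unfolding twist_def P_def Q_def by blast+
      show "l + m \<in> ?M \<and> decay w r (l + m) = decay w r l * decay w r m" if "l \<in> L" "m \<in> L" for l m
        using that LK by (auto intro!: image_eqI[of _ _ "(l, m)"] add)
    qed
    then have tw: "twist (decay w r) ?M (\<lambda>x. 1 - (\<Sum>i<m. p i x * q i x)) (\<lambda>x. 1 - (\<Sum>i<m. P r i x * Q r i x))"
      using M by (intro twist_diff twist_const twist_sum) auto
    have "unit (\<lambda>x. 1 - (1 - (\<Sum>i<m. P r i x * Q r i x)))"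
      by (rule unit_twist[OF tw M(1,3) K decay_0 add _ _ near])
        (use r in \<open>auto simp: K_def intro: norm_decay_le\<close>)
    then show ?thesis by simp
  qed
  have "completable m (P 1) \<longleftrightarrow> completable m (P 0)"
  proof (rule connected_equivalence_relation[of "{0..1::real}" 1 0 "\<lambda>r s. completable m (P r) \<longleftrightarrow> completable m (P s)"])
    fix r :: real assume r: "r \<in> {0..1}"
    obtain z where z: "z \<in> A" "\<And>x. (\<Sum>i<m. P r i x * Q r i x) * z x = 1"
      using unit[OF r] unfolding unit_def by blast
    \<comment> \<open>An upper bound, continuous in \<open>s\<close> and 0 at \<open>s = r\<close>, for the left-hand side of the
      smallness condition in \<open>completable_near\<close>.\<close>
    define E where "E s = N z * (\<Sum>i<m. (\<Sum>l\<in>L. norm (decay w r l * c i l - decay w s l * c i l)) * N (Q r i))" for s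
    have "continuous_on {0..1} E"
      unfolding E_def
    proof (intro continuous_intros continuous_on_decay)
      show "0 \<le> w \<bullet> l" if "l \<in> L" for l using that LK by (auto simp: K_def)
    qed
    then have "openin (top_of_set {0..1}) ({0..1} \<inter> E -` {..<1})"
      by (rule continuous_openin_preimage_gen) simp
    moreover have "r \<in> {0..1} \<inter> E -` {..<1}" using r by (simp add: E_def)
    moreover have "completable m (P r) \<longleftrightarrow> completable m (P s)" if s: "s \<in> {0..1} \<inter> E -` {..<1}" for s
    proof (rule completable_near[OF m PA PA QA z])
      have "N (\<lambda>x. P r i x - P s i x) \<le> (\<Sum>l\<in>L. norm (decay w r l * c i l - decay w s l * c i l))" for i
        using N_trig_poly[OF L(1,3)] by (simp add: P_def trig_poly_diff)
      then have "N z * (\<Sum>i<m. N (\<lambda>x. P r i x - P s i x) * N (Q r i)) \<le> E s"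
        unfolding E_def by (intro mult_left_mono sum_mono mult_right_mono N_nonneg z QA)
      then show "N z * (\<Sum>i<m. N (\<lambda>x. P r i x - P s i x) * N (Q r i)) < 1" using s by simp
    qed
    ultimately show "\<exists>T. openin (top_of_set {0..1}) T \<and> r \<in> T \<and> (\<forall>s\<in>T. completable m (P r) \<longleftrightarrow> completable m (P s))"
      by blast
  qed auto
  moreover have "completable m (P 0)"
  proof -
    \<comment> \<open>At \<open>r = 0\<close> only the constant terms survive, as \<open>w\<close> is positive on the other frequencies.\<close>
    have c0: "trig_poly L (\<lambda>l. decay w 0 l * e l) = (\<lambda>x. e 0)" for e
    proof
      fix x
      have "trig_poly L (\<lambda>l. decay w 0 l * e l) x = (\<Sum>l\<in>L. if l = 0 then e 0 else 0)"
        unfolding trig_poly_def using w by (intro sum.cong) (auto simp: decay_def)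
      then show "trig_poly L (\<lambda>l. decay w 0 l * e l) x = e 0" using L by simp
    qed
    have P0: "P 0 i = (\<lambda>x. c i 0)" and Q0: "Q 0 i = (\<lambda>x. d i 0)" for i
      unfolding P_def Q_def by (rule c0)+
    have "unit (\<lambda>x. \<Sum>i<m. c i 0 * d i 0)"
      using unit[of 0] by (simp add: P0 Q0)
    then have "(\<Sum>i<m. c i 0 * d i 0) \<noteq> 0" unfolding unit_def by auto
    then have "\<exists>i<m. c i 0 \<noteq> 0"
      by (metis (no_types, lifting) lessThan_iff mult_zero_left sum.neutral)
    then show ?thesis using completable_const[OF m, of "\<lambda>i. c i 0"] by (simp add: P0[abs_def] fun_eq_iff)
  qed
  ultimately have "completable m (P 1)" by blast
  moreover have "completable m p \<longleftrightarrow> completable m (P 1)"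
    using c by (auto simp: completable_def P_def)
  ultimately show ?thesis by blast
qed

text \<open>
  The column \<open>b\<close> is first replaced by exponential sums \<open>q\<close> so close to it that \<open>a q\<close> is still a unit; how
  close \<open>p\<close> must be to \<open>a\<close> depends on \<open>q\<close> and is decided afterwards.
\<close>

theorem unimodular_completable:
  assumes S: "halfspace S" "H \<subseteq> S" and m: "m \<ge> 1"
    and A: "\<And>i. i < m \<Longrightarrow> a i \<in> A" "\<And>i. i < m \<Longrightarrow> b i \<in> A"
    and ab: "\<And>x. (\<Sum>i<m. a i x * b i x) = 1"
  shows "completable m a"
proof -
  define e where "e = 1 / (4 * real m)"
  have e: "e > 0" using m by (simp add: e_def)
  have me: "(\<Sum>i<m. e) = 1 / 4" using m by (simp add: e_def)
  have "\<forall>i. i < m \<longrightarrow> (\<exists>q\<in>trig H. N (\<lambda>x. a i x * (b i x - q x)) \<le> e)"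
    using trig_dense_factor A e by blast
  then obtain q where q: "\<And>i. i < m \<Longrightarrow> q i \<in> trig H" "\<And>i. i < m \<Longrightarrow> N (\<lambda>x. a i x * (b i x - q i x)) \<le> e"
    by metis
  have qA: "q i \<in> A" if "i < m" for i using q(1)[OF that] by (rule trig_mem)
  have "\<forall>i. i < m \<longrightarrow> (\<exists>p\<in>trig H. N (\<lambda>x. q i x * (a i x - p x)) \<le> e)"
    using trig_dense_factor A e qA by blast
  then obtain p where p: "\<And>i. i < m \<Longrightarrow> p i \<in> trig H" "\<And>i. i < m \<Longrightarrow> N (\<lambda>x. q i x * (a i x - p i x)) \<le> e"
    by metis
  have pA: "p i \<in> A" if "i < m" for i using p(1)[OF that] by (rule trig_mem)
  define f where "f x = (\<Sum>i<m. a i x * (b i x - q i x))" for x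
  define g where "g x = (\<Sum>i<m. q i x * (a i x - p i x))" for x
  have fA: "f \<in> A" and gA: "g \<in> A"
    unfolding f_def g_def by (auto intro!: sum mult diff A qA pA)
  have "N f \<le> (\<Sum>i<m. N (\<lambda>x. a i x * (b i x - q i x)))"
    unfolding f_def by (auto intro!: N_sum mult diff A qA)
  also have "\<dots> \<le> (\<Sum>i<m. e)" using q(2) by (intro sum_mono) auto
  finally have Nf: "N f \<le> 1 / 4" by (simp only: me)
  have "N g \<le> (\<Sum>i<m. N (\<lambda>x. q i x * (a i x - p i x)))"
    unfolding g_def by (auto intro!: N_sum mult diff A qA pA)
  also have "\<dots> \<le> (\<Sum>i<m. e)" using p(2) by (intro sum_mono) auto
  finally have Ng: "N g \<le> 1 / 4" by (simp only: me)
  have aq: "(\<Sum>i<m. a i x * q i x) = 1 - f x" for x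
    unfolding f_def ab[of x, symmetric] sum_subtractf[symmetric] by (intro sum.cong) (auto simp: algebra_simps)
  have pq: "(\<Sum>i<m. p i x * q i x) = 1 - (f x + g x)" for x
  proof -
    have "(\<Sum>i<m. p i x * q i x) = (\<Sum>i<m. a i x * q i x) - g x"
      unfolding g_def sum_subtractf[symmetric] by (intro sum.cong) (auto simp: algebra_simps)
    then show ?thesis by (simp add: aq)
  qed
  have N_fg: "N (\<lambda>x. f x + g x) \<le> 1 / 2" using N_add[OF fA gA] Nf Ng by simp
  have "completable m p"
  proof (rule completable_trig[OF S m p(1) q(1)])
    show "norm (1 - (\<Sum>i<m. p i x * q i x)) \<le> 1 / 2" for x
      using norm_le_N[OF add[OF fA gA], of x] N_fg by (simp add: pq)
  qed
  then show ?thesis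
  proof (rule completable_transfer_unit[OF m A(1) pA qA, rotated -1])
    show "unit (\<lambda>x. \<Sum>i<m. a i x * q i x)"
      unfolding aq by (rule unit_near_1[OF fA]) (use Nf in simp)
    show "unit (\<lambda>x. \<Sum>i<m. p i x * q i x)"
      unfolding pq by (rule unit_near_1[OF add[OF fA gA]]) (use N_fg in simp)
  qed
qed

end

section \<open>The two algebras\<close>

lemma trig_algebra_AP_on:
  fixes H :: "(real ^ 'n) set"
  assumes H: "0 \<in> H" "\<And>l m. l \<in> H \<Longrightarrow> m \<in> H \<Longrightarrow> l + m \<in> H"
  shows "trig_algebra (AP_on H) H (\<lambda>f. SUP x. norm (f x))"
proof -
  have bdd: "bdd_above (range (\<lambda>x. norm (f x)))" if f: "f \<in> AP_on H" for f
  proof -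
    obtain B where "\<forall>x. norm (f x) \<le> B" using AP_bounded[of f] f unfolding AP_on_def by blast
    then show ?thesis by (intro bdd_aboveI2) auto
  qed
  have up: "norm (f x) \<le> (SUP x. norm (f x))" if "f \<in> AP_on H" for f x
    by (rule cSUP_upper[OF UNIV_I bdd[OF that]])
  have least: "(SUP x. norm (f x)) \<le> B" if "\<And>x. norm (f x) \<le> B" for f :: "real ^ 'n \<Rightarrow> complex" and B
    using that by (intro cSUP_least) auto
  have memtrig: "f \<in> AP_on H" if "f \<in> trig H" for f
    using that by (simp add: AP_on_eq_trig_closure trig_subset_closure)
  show ?thesis
  proof
    show "(\<lambda>x. c) \<in> AP_on H" for c
      using memtrig[OF trig_scale[OF trig_expo[OF H(1)], of c]] by simp
    fix f g :: "real ^ 'n \<Rightarrow> complex"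
    assume fg: "f \<in> AP_on H" "g \<in> AP_on H"
    show "(\<lambda>x. f x + g x) \<in> AP_on H" using fg unfolding AP_on_eq_trig_closure by (rule trig_closure_add)
    show "(\<lambda>x. f x * g x) \<in> AP_on H" using fg H(2) unfolding AP_on_eq_trig_closure by (rule trig_closure_mult)
    show "(SUP x. norm (f x + g x)) \<le> (SUP x. norm (f x)) + (SUP x. norm (g x))"
      by (intro least norm_triangle_le add_mono up fg)
    show "(SUP x. norm (f x * g x)) \<le> (SUP x. norm (f x)) * (SUP x. norm (g x))"
      unfolding norm_mult[symmetric] by (rule least) (simp add: norm_mult mult_mono up fg order_trans[OF norm_ge_zero up])
  next
    show "0 \<in> H" by (rule H(1))
    show "l + m \<in> H" if "l \<in> H" "m \<in> H" for l m using that by (rule H(2))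
    fix f :: "real ^ 'n \<Rightarrow> complex"
    assume f: "f \<in> AP_on H"
    show "norm (f x) \<le> (SUP x. norm (f x))" for x by (rule up[OF f])
    fix e :: real assume e: "e > 0"
    obtain p where p: "p \<in> trig H" "\<forall>x. norm (f x - p x) \<le> e"
      using f e unfolding AP_on_eq_trig_closure trig_closure_def by blast
    then show "\<exists>p\<in>trig H. (SUP x. norm (f x - p x)) \<le> e" by (intro bexI[OF least p(1)]) auto
  next
    fix L :: "(real ^ 'n) set" and c assume L: "finite L" "L \<subseteq> H"
    show "trig_poly L c \<in> AP_on H" by (intro memtrig trig_polyI L)
    show "(SUP x. norm (trig_poly L c x)) \<le> (\<Sum>l\<in>L. norm (c l))"
      unfolding trig_poly_def by (intro least sum_norm_le) (simp add: norm_mult)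
  next
    fix F :: "nat \<Rightarrow> real ^ 'n \<Rightarrow> complex"
    assume F: "\<And>n. F n \<in> AP_on H" and s: "summable (\<lambda>n. SUP x. norm (F n x))"
    have lim: "uniform_limit UNIV (\<lambda>n x. \<Sum>i<n. F i x) (\<lambda>x. \<Sum>i. F i x) sequentially"
      by (rule Weierstrass_m_test[OF _ s]) (rule up[OF F])
    have part: "(\<lambda>x. \<Sum>i<n. F i x) \<in> trig_closure H" for n
    proof (induction n)
      case 0
      show ?case using trig_subset_closure[OF trig_scale[OF trig_expo[OF H(1)], of 0]] by simp
    next
      case (Suc n)
      show ?case using trig_closure_add[OF Suc F[of n, unfolded AP_on_eq_trig_closure]] by simp
    qed
    show "(\<lambda>x. \<Sum>n. F n x) \<in> AP_on H"
      unfolding AP_on_eq_trig_closure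
    proof (rule trig_closure_limit)
      fix e :: real assume "e > 0"
      then obtain n where "\<And>x. dist (\<Sum>i<n. F i x) (\<Sum>i. F i x) < e"
        using uniform_limitD[OF lim, of e] by (auto simp: eventually_sequentially)
      then show "\<exists>g\<in>trig_closure H. \<forall>x. norm ((\<Sum>i. F i x) - g x) \<le> e"
        by (intro bexI[OF _ part[of n]]) (simp add: dist_norm norm_minus_commute less_imp_le)
    qed
  qed
qed

lemma wiener_norm_0: "wiener_norm (\<lambda>x :: real ^ 'n. 0) = 0"
  using wiener_norm_trig_poly(2)[of "{}" "\<lambda>_ :: real ^ 'n. 0"] wiener_norm_nonneg[of "\<lambda>x :: real ^ 'n. 0"]
  by (simp add: trig_poly_def)

lemma APW_on_iff: "f \<in> APW_on H \<longleftrightarrow> f \<in> APW \<and> bohr_spectrum f \<subseteq> H"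
  by (simp add: APW_on_def)

lemma APW_0: "(\<lambda>x :: real ^ 'n. 0) \<in> APW" and bohr_spectrum_0: "bohr_spectrum (\<lambda>x :: real ^ 'n. 0) = {}"
  using wiener_norm_trig_poly[of "{}" "\<lambda>_ :: real ^ 'n. 0"] by (simp_all add: trig_poly_def)

text \<open>
  The sum of two functions is regarded as a series with two nonzero terms.
\<close>

lemma APW_add:
  fixes f g :: "real ^ 'n \<Rightarrow> complex"
  assumes "f \<in> APW" "g \<in> APW"
  shows "(\<lambda>x. f x + g x) \<in> APW"
    and "wiener_norm (\<lambda>x. f x + g x) \<le> wiener_norm f + wiener_norm g"
    and "bohr_spectrum (\<lambda>x. f x + g x) \<subseteq> bohr_spectrum f \<union> bohr_spectrum g"
proof -
  define F where "F n = (if n = 0 then f else if n = 1 then g else (\<lambda>x. 0))" for n :: nat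
  have FA: "F n \<in> APW" for n using assms by (simp add: F_def APW_0)
  have sums: "(\<lambda>n. wiener_norm (F n)) sums (\<Sum>n\<in>{0, 1}. wiener_norm (F n))"
    by (rule sums_finite) (auto simp: F_def wiener_norm_0)
  have "(\<Sum>n. F n x) = (\<Sum>n\<in>{0, 1}. F n x)" for x
    by (rule suminf_finite) (auto simp: F_def)
  then have eq: "(\<lambda>x. \<Sum>n. F n x) = (\<lambda>x. f x + g x)" by (simp add: F_def)
  note w = APW_suminf[of F, OF FA sums_summable[OF sums], unfolded eq]
  show "(\<lambda>x. f x + g x) \<in> APW" by (rule w(1))
  show "wiener_norm (\<lambda>x. f x + g x) \<le> wiener_norm f + wiener_norm g"
    using w(2) sums_unique[OF sums] by (simp add: F_def)
  show "bohr_spectrum (\<lambda>x. f x + g x) \<subseteq> bohr_spectrum f \<union> bohr_spectrum g"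
    by (rule order_trans[OF w(3)]) (auto simp: F_def bohr_spectrum_0 split: if_splits)
qed

text \<open>
  Partial sums of the Bohr-Fourier series converge in the Wiener norm.
\<close>

lemma APW_dense:
  assumes f: "f \<in> APW" and e: "e > 0"
  shows "\<exists>p\<in>trig (bohr_spectrum f). wiener_norm (\<lambda>x. f x - p x) \<le> e"
proof -
  let ?S = "bohr_spectrum f"
  note s = APW_summable[OF f]
  obtain M where M: "finite M" "M \<subseteq> ?S"
    and close: "dist (\<Sum>l\<in>M. norm (bohr_coeff f l)) (\<Sum>\<^sub>\<infinity>l\<in>?S. norm (bohr_coeff f l)) \<le> e"
    using infsum_finite_approximation[OF s e] by blast
  have s': "(\<lambda>l. norm (bohr_coeff f l)) summable_on ?S - M"
    by (rule summable_on_subset_banach[OF s]) auto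
  let ?p = "trig_poly M (bohr_coeff f)"
  have eq: "(\<lambda>x. f x - ?p x) = (\<lambda>x. \<Sum>\<^sub>\<infinity>l\<in>?S - M. bohr_coeff f l * expo l x)"
  proof
    fix x
    have "(\<Sum>\<^sub>\<infinity>l\<in>?S - M. bohr_coeff f l * expo l x)
        = (\<Sum>\<^sub>\<infinity>l\<in>?S. bohr_coeff f l * expo l x) - (\<Sum>\<^sub>\<infinity>l\<in>M. bohr_coeff f l * expo l x)"
      by (rule infsum_Diff[OF abs_summable_expo[OF s] summable_on_finite[OF M(1)] M(2)])
    also have "(\<Sum>\<^sub>\<infinity>l\<in>?S. bohr_coeff f l * expo l x) = f x"
      using APW_expansion[OF f] by metis
    finally show "f x - ?p x = (\<Sum>\<^sub>\<infinity>l\<in>?S - M. bohr_coeff f l * expo l x)"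
      using M(1) by (simp add: trig_poly_def)
  qed
  have "wiener_norm (\<lambda>x. f x - ?p x) \<le> (\<Sum>\<^sub>\<infinity>l\<in>?S - M. norm (bohr_coeff f l))"
    by (rule wiener_expo_sum(2)[OF s' eq])
  also have "\<dots> = (\<Sum>\<^sub>\<infinity>l\<in>?S. norm (bohr_coeff f l)) - (\<Sum>l\<in>M. norm (bohr_coeff f l))"
    using infsum_Diff[OF s summable_on_finite[OF M(1)] M(2)] M(1) by simp
  also have "\<dots> \<le> e" using close by (simp add: dist_real_def abs_le_iff)
  finally show ?thesis using trig_polyI[OF M] by blast
qed

lemma trig_algebra_APW_on:
  fixes H :: "(real ^ 'n) set"
  assumes H: "0 \<in> H" "\<And>l m. l \<in> H \<Longrightarrow> m \<in> H \<Longrightarrow> l + m \<in> H"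
  shows "trig_algebra (APW_on H) H wiener_norm"
proof
  have memtrig: "trig_poly L c \<in> APW_on H" if "finite L" "L \<subseteq> H" for L c
    using wiener_norm_trig_poly[OF that(1), of c] that(2) by (auto simp: APW_on_iff)
  show "(\<lambda>x. c) \<in> APW_on H" for c
    using memtrig[of "{0}" "\<lambda>_. c"] H(1) by (simp add: trig_poly_def)
  show "0 \<in> H" by (rule H(1))
  show "l + m \<in> H" if "l \<in> H" "m \<in> H" for l m using that by (rule H(2))
  fix L :: "(real ^ 'n) set" and c assume L: "finite L" "L \<subseteq> H"
  show "trig_poly L c \<in> APW_on H" by (rule memtrig[OF L])
  show "wiener_norm (trig_poly L c) \<le> (\<Sum>l\<in>L. norm (c l))"
    by (rule wiener_norm_trig_poly(2)[OF L(1)])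
next
  fix f g :: "real ^ 'n \<Rightarrow> complex"
  assume fg: "f \<in> APW_on H" "g \<in> APW_on H"
  then have *: "f \<in> APW" "g \<in> APW" "bohr_spectrum f \<subseteq> H" "bohr_spectrum g \<subseteq> H"
    by (auto simp: APW_on_iff)
  show "(\<lambda>x. f x + g x) \<in> APW_on H"
    using APW_add[OF *(1,2)] *(3,4) by (auto simp: APW_on_iff)
  have "(\<lambda>i. fst i + snd i) ` (bohr_spectrum f \<times> bohr_spectrum g) \<subseteq> H"
    using *(3,4) by (auto intro!: H(2))
  then show "(\<lambda>x. f x * g x) \<in> APW_on H"
    using APW_mult(1,3)[OF *(1,2)] by (auto simp: APW_on_iff)
  show "wiener_norm (\<lambda>x. f x + g x) \<le> wiener_norm f + wiener_norm g"
    by (rule APW_add(2)[OF *(1,2)])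
  show "wiener_norm (\<lambda>x. f x * g x) \<le> wiener_norm f * wiener_norm g"
    by (rule APW_mult(2)[OF *(1,2)])
next
  fix f :: "real ^ 'n \<Rightarrow> complex" assume f: "f \<in> APW_on H"
  show "norm (f x) \<le> wiener_norm f" for x
    using f by (intro norm_le_wiener_norm) (simp add: APW_on_iff)
  fix e :: real assume "e > 0"
  then show "\<exists>p\<in>trig H. wiener_norm (\<lambda>x. f x - p x) \<le> e"
    using APW_dense[of f e] f trig_mono[of "bohr_spectrum f" H] by (auto simp: APW_on_iff)
next
  fix F :: "nat \<Rightarrow> real ^ 'n \<Rightarrow> complex"
  assume F: "\<And>n. F n \<in> APW_on H" and s: "summable (\<lambda>n. wiener_norm (F n))"
  have FA: "F n \<in> APW" "bohr_spectrum (F n) \<subseteq> H" for n using F[of n] by (auto simp: APW_on_iff)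
  have "(\<Union>n. bohr_spectrum (F n)) \<subseteq> H" using FA(2) by blast
  then show "(\<lambda>x. \<Sum>n. F n x) \<in> APW_on H"
    using APW_suminf(1,3)[OF FA(1) s] by (auto simp: APW_on_iff)
qed

theorem theorem1p2:
  fixes S H :: "(real ^ 'n) set"
  assumes "halfspace S"
    and "H \<subseteq> S"
    and "\<And>l m. l \<in> H \<Longrightarrow> m \<in> H \<Longrightarrow> l + m \<in> H"
    and "0 \<in> H"
  shows "hermite_ring (function_ring (AP_on H)) \<and> hermite_ring (function_ring (APW_on H))"
proof
  interpret AP: trig_algebra "AP_on H" H "\<lambda>f. SUP x. norm (f x)"
    using assms(3,4) by (intro trig_algebra_AP_on)
  show "hermite_ring (function_ring (AP_on H))"
    by (rule AP.hermite_function_ring) (rule AP.unimodular_completable[OF assms(1,2)])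
  interpret APW: trig_algebra "APW_on H" H wiener_norm
    using assms(3,4) by (intro trig_algebra_APW_on)
  show "hermite_ring (function_ring (APW_on H))"
    by (rule APW.hermite_function_ring) (rule APW.unimodular_completable[OF assms(1,2)])
qed

end
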